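(* Let $SO(3)$ act by pullback on the space $\mathcal{H}_3(\mathbb{R}^3)$ of harmonic homogeneous cubic polynomials in $x,y,z$. The $SO(3)$-stabilizer of $h\in\mathcal{H}_3(\mathbb{R}^3)$ is nontrivial if and only if $h$ lies on the $SO(3)$-orbit of exactly one of the following polynomials: 1. $0\in\mathcal{H}_3(\mathbb{R}^3)$, whose stabilizer is $SO(3)$. 2. $r\,(2z^3-3zx^2-3zy^2)$ for some $r>0$, whose stabilizer is $SO(2)$ (the rotations about the $z$-axis). 3. $6s\,xyz$ for some $s>0$, whose stabilizer is the subgroup $A_4\subset SO(3)$ of order $12$ generated by the rotations by an angle of $\pi$ about the $x$-, $y$-, and $z$-axes and by rotation by an angle of $\frac23\pi$ about the line $x=y=z$. 4. $s\,(x^3-3xy^2)$ for some $s>0$, whose stabilizer is the subgroup $S_3\subset SO(3)$ of order $6$ generated by the rotation by an angle of $\pi$ about the $x$-axis and the rotation by an angle of $\frac23\pi$ about the $z$-axis. 5. $r\,(2z^3-3zx^2-3zy^2)+6s\,xyz$ for some $r,s>0$ satisfying $s\neq r$, whose stabilizer is the $\mathbb{Z}_2$-subgroup of $SO(3)$ generated by rotation by an angle of $\pi$ about the $z$-axis. 6. $r\,(2z^3-3zx^2-3zy^2)+s\,(x^3-3xy^2)$ for some $r,s>0$ satisfying $s\neq r\sqrt2$, whose stabilizer is the $\mathbb{Z}_3$-subgroup of $SO(3)$ generated by rotation by an angle of $\frac23\pi$ about the $z$-axis.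
   Context: $\mathcal{H}_3(\mathbb{R}^3)$ is the $7$-dimensional real vector space of polynomials on $\mathbb{R}^3$ that are homogeneous of degree $3$ and harmonic (annihilated by the Euclidean Laplacian). Different parameter values in items 2–6 count as different polynomials in the list. *)

theory Defs
  imports "HOL-Analysis.Analysis" "HOL-Algebra.Algebra"
begin

definition SO :: "(real^'n^'n) monoid"
  where "SO = \<lparr>carrier = {A. rotation_matrix A}, mult = (**), one = mat 1\<rparr>"

text \<open>
  Pullback by A is a right action, since (A ** B)* = B* o A*.  The constants
  \<^term>\<open>orbit\<close> and \<^term>\<open>stabilizer\<close> only involve the images of \<^term>\<open>h\<close> under
  the group elements, so they are meaningful for it as they stand; they agree with those
  of the left action \<^term>\<open>\<lambda>A h. pullback (transpose A) h\<close>.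
\<close>

definition pullback :: "real^'n^'n \<Rightarrow> (real^'n \<Rightarrow> real) \<Rightarrow> real^'n \<Rightarrow> real"
  where "pullback A h = (\<lambda>v. h (A *v v))"

lemma pullback_mult: "pullback (A ** B) h = pullback B (pullback A h)"
  by (simp add: pullback_def matrix_vector_mul_assoc)

definition partial :: "'n::finite \<Rightarrow> (real^'n \<Rightarrow> real) \<Rightarrow> real^'n \<Rightarrow> real"
  where "partial i f v = deriv (\<lambda>t. f (v + t *\<^sub>R axis i 1)) 0"

definition laplacian :: "(real^'n::finite \<Rightarrow> real) \<Rightarrow> real^'n \<Rightarrow> real"
  where "laplacian f v = (\<Sum>i\<in>UNIV. partial i (partial i f) v)"

text \<open>Polynomials are identified with the functions they induce.\<close>

definition harmonic_homogeneous :: "nat \<Rightarrow> (real^'n::finite \<Rightarrow> real) set"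
  where "harmonic_homogeneous k =
    {h. real_polynomial_function h \<and> (\<forall>c v. h (c *\<^sub>R v) = c ^ k * h v) \<and> (\<forall>v. laplacian h v = 0)}"

text \<open>
  Rodrigues' formula: the rotation by the angle \<^term>\<open>\<theta>\<close> about the line spanned by
  \<^term>\<open>u \<noteq> 0\<close>, counterclockwise when seen from the tip of \<^term>\<open>u\<close>.
\<close>

definition rotation_about :: "real^3 \<Rightarrow> real \<Rightarrow> real^3^3"
  where "rotation_about u \<theta> =
    (let n = sgn u in
       matrix (\<lambda>v. cos \<theta> *\<^sub>R v + sin \<theta> *\<^sub>R cross3 n v + ((1 - cos \<theta>) * (n \<bullet> v)) *\<^sub>R n))"

abbreviation x_axis :: "real^3" where "x_axis \<equiv> axis 1 1"
abbreviation y_axis :: "real^3" where "y_axis \<equiv> axis 2 1"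
abbreviation z_axis :: "real^3" where "z_axis \<equiv> axis 3 1"

text \<open>
  The list of polynomials.  Its entries are indexed by a datatype, so that entries of
  different type or with different parameters count as different.
\<close>

datatype form =
    Form_SO3
  | Form_SO2 real
  | Form_A4 real
  | Form_S3 real
  | Form_Z2 real real
  | Form_Z3 real real

fun admissible :: "form \<Rightarrow> bool" where
  "admissible Form_SO3 \<longleftrightarrow> True"
| "admissible (Form_SO2 r) \<longleftrightarrow> r > 0"
| "admissible (Form_A4 s) \<longleftrightarrow> s > 0"
| "admissible (Form_S3 s) \<longleftrightarrow> s > 0"
| "admissible (Form_Z2 r s) \<longleftrightarrow> r > 0 \<and> s > 0 \<and> s \<noteq> r"
| "admissible (Form_Z3 r s) \<longleftrightarrow> r > 0 \<and> s > 0 \<and> s \<noteq> r * sqrt 2"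

definition cubic_SO2 :: "real^3 \<Rightarrow> real"
  where "cubic_SO2 v = (let x = v$1; y = v$2; z = v$3 in 2 * z^3 - 3 * z * x^2 - 3 * z * y^2)"

definition cubic_A4 :: "real^3 \<Rightarrow> real"
  where "cubic_A4 v = (let x = v$1; y = v$2; z = v$3 in x * y * z)"

definition cubic_S3 :: "real^3 \<Rightarrow> real"
  where "cubic_S3 v = (let x = v$1; y = v$2 in x^3 - 3 * x * y^2)"

fun cubic :: "form \<Rightarrow> real^3 \<Rightarrow> real" where
  "cubic Form_SO3 = (\<lambda>v. 0)"
| "cubic (Form_SO2 r) = (\<lambda>v. r * cubic_SO2 v)"
| "cubic (Form_A4 s) = (\<lambda>v. 6 * s * cubic_A4 v)"
| "cubic (Form_S3 s) = (\<lambda>v. s * cubic_S3 v)"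
| "cubic (Form_Z2 r s) = (\<lambda>v. r * cubic_SO2 v + 6 * s * cubic_A4 v)"
| "cubic (Form_Z3 r s) = (\<lambda>v. r * cubic_SO2 v + s * cubic_S3 v)"

abbreviation SO3 :: "(real^3^3) monoid" where "SO3 \<equiv> SO"
abbreviation SO2 :: "(real^2^2) monoid" where "SO2 \<equiv> SO"

abbreviation stab :: "(real^3 \<Rightarrow> real) \<Rightarrow> (real^3^3) set"
  where "stab h \<equiv> stabilizer SO3 pullback h"

abbreviation stab_group :: "(real^3 \<Rightarrow> real) \<Rightarrow> (real^3^3) monoid"
  where "stab_group h \<equiv> SO3\<lparr>carrier := stab h\<rparr>"

end

theory Submission
  imports Defs
begin

text \<open>
  With \<open>\<zeta> = x + i y\<close>, a harmonic cubic is
  \<open>a (2 z\<^sup>3 - 3 z |\<zeta>|\<^sup>2) + Re (b \<zeta>) (4 z\<^sup>2 - |\<zeta>|\<^sup>2) + z Re (c \<zeta>\<^sup>2) + Re (d \<zeta>\<^sup>3)\<close>,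
  and the rotation \<open>\<zeta> \<mapsto> w \<zeta>\<close> multiplies \<open>b, c, d\<close> by \<open>w, w\<^sup>2, w\<^sup>3\<close>. A nontrivial rotation in the
  stabilizer has an axis, which we move to the \<open>z\<close>-axis; then \<open>b = 0\<close> and one of \<open>c, d\<close> vanishes, and
  rotations about the \<open>z\<close>-axis and the half turn about the \<open>x\<close>-axis make the remaining coefficients
  nonnegative multiples of those in the list.

  The stabilizers are bounded with the quadratic covariant \<open>(u, v) \<mapsto> trace (Hess u Hess v)\<close>: for
  all forms but the tetrahedral one, the \<open>z\<close>-axis is a simple eigenspace of it, so that the stabilizer
  preserves this axis. The tetrahedral stabilizer permutes the zero planes of \<open>x y z\<close>. The order of
  the stabilizer distinguishes the types, and maxima on a sphere (or the preserved axis) recover the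
  parameters.
\<close>

section \<open>Rotation groups, stabilizers and orbits\<close>

text \<open>The two excluded relations between parameters are exactly where the quadratic covariant
  fails to single out the \<open>z\<close>-axis. At \<open>s = r\<close> the form is an
  \<open>S3\<close> form whose own axis points elsewhere; at \<open>s = r * sqrt 2\<close> it is a
  tetrahedral form. For \<open>x y z\<close> the covariant is a multiple of the inner product and
  carries no information, so its stabilizer needs the zero planes instead. Hessians are obtained by
  polarization, which makes their behaviour under rotations pure algebra, without a chain rule. The
  abstract types \<open>A4\<close> and \<open>S3\<close> come from vectors whose permutations extend
  to orthogonal maps. This gives an injective homomorphism into the stabilizer, and a separate upper
  bound on the order of the stabilizer makes it onto.\<close>

declare transpose_matrix_vector [simp del]

lemma rotation_matrix_mult: "rotation_matrix A \<Longrightarrow> rotation_matrix B \<Longrightarrow> rotation_matrix (A ** B)"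
  for A B :: "real^'n^'n"
  by (simp add: rotation_matrix_def orthogonal_matrix_mul det_mul)

lemma SO_simps [simp]:
  "A \<in> carrier SO \<longleftrightarrow> rotation_matrix A" "A \<otimes>\<^bsub>SO\<^esub> B = A ** B" "\<one>\<^bsub>SO\<^esub> = mat 1"
  by (simp_all add: SO_def)

lemma rotation_matrix_one: "rotation_matrix (mat 1 :: real^'n^'n)"
  by (simp add: rotation_matrix_def orthogonal_matrix_id)

lemma rotation_matrix_transpose: "rotation_matrix A \<Longrightarrow> rotation_matrix (transpose A)"
  for A :: "real^'n^'n"
  by (simp add: rotation_matrix_def orthogonal_matrix_transpose det_transpose)

lemma rotation_matrix_inverse:
  fixes A :: "real^'n^'n"
  assumes "rotation_matrix A"
  shows "transpose A ** A = mat 1" "A ** transpose A = mat 1"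
  using assms by (auto simp: rotation_matrix_def orthogonal_matrix_def)

lemma rotation_matrix_cancel:
  fixes A :: "real^'n^'n"
  assumes "rotation_matrix A"
  shows "transpose A *v (A *v v) = v" "A *v (transpose A *v v) = v"
    "transpose A ** (A ** B) = B" "A ** (transpose A ** B) = B"
  using rotation_matrix_inverse[OF assms]
  by (simp_all add: matrix_vector_mul_assoc matrix_mul_assoc)

lemma group_SO: "group (SO :: (real^'n^'n) monoid)"
proof (rule groupI)
  fix A :: "real^'n^'n" assume "A \<in> carrier SO"
  then show "\<exists>y\<in>carrier SO. y \<otimes>\<^bsub>SO\<^esub> A = \<one>\<^bsub>SO\<^esub>"
    by (intro bexI[of _ "transpose A"]) (auto simp: rotation_matrix_transpose rotation_matrix_inverse)
qed (auto simp: rotation_matrix_mult matrix_mul_assoc rotation_matrix_one)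

lemma inv_SO:
  fixes A :: "real^'n^'n"
  assumes "rotation_matrix A"
  shows "inv\<^bsub>SO\<^esub> A = transpose A"
  using assms by (intro group.inv_equality[OF group_SO])
    (auto simp: rotation_matrix_transpose rotation_matrix_inverse)

lemma inner_rotation_matrix: 
  fixes A :: "real^'n^'n"
  assumes "rotation_matrix A" shows "(A *v u) \<bullet> (A *v v) = u \<bullet> v"
  using assms by (metis dot_lmul_matrix rotation_matrix_cancel(1) vector_transpose_matrix transpose_transpose)

lemma norm_rotation_matrix: "rotation_matrix A \<Longrightarrow> norm (A *v v) = norm v"
  for A :: "real^'n^'n"
  by (simp add: norm_eq_sqrt_inner inner_rotation_matrix)

lemma stab_iff: "g \<in> stab h \<longleftrightarrow> rotation_matrix g \<and> (\<forall>v. h (g *v v) = h v)"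
  by (auto simp: stabilizer_def pullback_def fun_eq_iff)

lemma orbit_iff: "k \<in> orbit SO3 pullback h \<longleftrightarrow> (\<exists>g. rotation_matrix g \<and> k = pullback g h)"
  by (auto simp: orbit_def)

lemma subgroup_stab: "subgroup (stab h) SO3"
proof (rule group.subgroupI[OF group_SO])
  have "mat 1 \<in> stab h"
    by (simp add: stab_iff rotation_matrix_one)
  then show "stab h \<noteq> {}" by blast
next
  fix g assume g: "g \<in> stab h"
  then have "h (transpose g *v v) = h v" for v
    by (metis rotation_matrix_cancel(2) stab_iff)
  then show "inv\<^bsub>SO3\<^esub> g \<in> stab h"
    using g by (simp add: stab_iff inv_SO rotation_matrix_transpose)
next
  fix g k assume "g \<in> stab h" "k \<in> stab h"
  then show "g \<otimes>\<^bsub>SO3\<^esub> k \<in> stab h"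
    by (simp add: stab_iff rotation_matrix_mult flip: matrix_vector_mul_assoc)
qed (auto simp: stab_iff)

lemma stab_pullback:
  assumes "rotation_matrix R"
  shows "stab (pullback R h) = (\<lambda>g. transpose R ** g ** R) ` stab h"
proof (intro equalityI subsetI)
  fix g assume g: "g \<in> stab (pullback R h)"
  have "h (R *v (g *v (transpose R *v v))) = h v" for v
    using g by (metis pullback_def rotation_matrix_cancel(2)[OF assms] stab_iff)
  then have "R ** g ** transpose R \<in> stab h"
    using assms g by (auto simp: stab_iff rotation_matrix_mult rotation_matrix_transpose
        simp flip: matrix_vector_mul_assoc)
  moreover have "g = transpose R ** (R ** g ** transpose R) ** R"
    using assms by (simp add: rotation_matrix_cancel rotation_matrix_inverse flip: matrix_mul_assoc)
  ultimately show "g \<in> (\<lambda>g. transpose R ** g ** R) ` stab h" by blast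
next
  fix g assume "g \<in> (\<lambda>g. transpose R ** g ** R) ` stab h"
  then show "g \<in> stab (pullback R h)"
    using assms by (auto simp: stab_iff pullback_def rotation_matrix_mult rotation_matrix_transpose
        rotation_matrix_cancel simp flip: matrix_vector_mul_assoc)
qed

lemma inj_conjugate:
  fixes R :: "real^'n^'n"
  assumes "rotation_matrix R"
  shows "inj (\<lambda>g. transpose R ** g ** R)"
proof (rule injI)
  fix g k assume "transpose R ** g ** R = transpose R ** k ** R"
  then have "R ** (transpose R ** g ** R) ** transpose R = R ** (transpose R ** k ** R) ** transpose R"
    by simp
  then show "g = k"
    using assms by (simp add: rotation_matrix_cancel rotation_matrix_inverse flip: matrix_mul_assoc)
qed

lemma pullback_inverse:
  assumes "rotation_matrix R"
  shows "pullback (transpose R) (pullback R h) = h" "pullback R (pullback (transpose R) h) = h"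
  using assms by (simp_all add: pullback_def fun_eq_iff rotation_matrix_cancel)

lemma orbit_sym:
  "k \<in> orbit SO3 pullback h \<Longrightarrow> h \<in> orbit SO3 pullback k"
  by (metis orbit_iff pullback_inverse(1) rotation_matrix_transpose)

lemma orbit_trans:
  "k \<in> orbit SO3 pullback h \<Longrightarrow> l \<in> orbit SO3 pullback k \<Longrightarrow> l \<in> orbit SO3 pullback h"
  by (metis orbit_iff pullback_mult rotation_matrix_mult)

lemma orbit_refl: "h \<in> orbit SO3 pullback h"
  by (auto simp: orbit_iff pullback_def intro!: exI[of _ "mat 1"] rotation_matrix_one)

text \<open>\<open>det (A - 1) = det (A - A A\<^sup>T) = det (1 - A\<^sup>T) = - det (A - 1)\<close> in odd dimension.\<close>
lemma rotation_matrix_axis: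
  fixes A :: "real^3^3"
  assumes "rotation_matrix A"
  obtains u where "norm u = 1" "A *v u = u"
proof -
  have "A ** (mat 1 - transpose A) = A ** mat 1 - A ** transpose A"
    by (simp add: matrix_matrix_mult_def vec_eq_iff algebra_simps sum_subtractf)
  then have "A - mat 1 = A ** (mat 1 - transpose A)"
    using assms by (simp add: rotation_matrix_inverse)
  also have "det \<dots> = det (transpose (mat 1 - A))"
    using assms by (simp add: det_mul rotation_matrix_def) (simp add: transpose_def mat_def vec_eq_iff det_3)
  also have "\<dots> = - det (A - mat 1)"
    unfolding det_transpose by (simp add: det_3 algebra_simps)
  finally have "\<not> invertible (A - mat 1)" by (simp add: invertible_det_nz)
  then obtain x where x: "(A - mat 1) *v x = 0" "x \<noteq> 0"
    by (auto simp: invertible_left_inverse matrix_left_invertible_ker)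
  then have "A *v x = x" by (simp add: matrix_vector_mult_diff_rdistrib)
  then show ?thesis
    using x by (intro that[of "sgn x"]) (auto simp: norm_sgn sgn_div_norm matrix_vector_mult_scaleR)
qed

lemma rotation_matrix_entries:
  fixes A :: "real^3^3"
  assumes "rotation_matrix A"
  shows "A$1$i * A$1$j + A$2$i * A$2$j + A$3$i * A$3$j = (if i = j then 1 else 0)"
    "A$i$1 * A$j$1 + A$i$2 * A$j$2 + A$i$3 * A$j$3 = (if i = j then 1 else 0)"
proof -
  have "(transpose A ** A)$i$j = mat 1$i$j" "(A ** transpose A)$i$j = mat 1$i$j"
    by (simp_all add: rotation_matrix_inverse[OF assms])
  then show "A$1$i * A$1$j + A$2$i * A$2$j + A$3$i * A$3$j = (if i = j then 1 else 0)"
    "A$i$1 * A$j$1 + A$i$2 * A$j$2 + A$i$3 * A$j$3 = (if i = j then 1 else 0)"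
    by (auto simp: matrix_matrix_mult_def sum_3 transpose_def mat_def split: if_splits)
qed

section \<open>Cubic forms\<close>

definition monomial3 :: "nat \<times> nat \<times> nat \<Rightarrow> real^3 \<Rightarrow> real" where
  "monomial3 = (\<lambda>(i, j, k) v. v$1^i * v$2^j * v$3^k)"

definition cubic_exponents :: "(nat \<times> nat \<times> nat) set" where
  "cubic_exponents =
    {(3,0,0), (0,3,0), (0,0,3), (2,1,0), (2,0,1), (1,2,0), (0,2,1), (1,0,2), (0,1,2), (1,1,1)}"

lemma cubic_exponents_iff: "(i, j, k) \<in> cubic_exponents \<longleftrightarrow> i + j + k = 3"
proof
  assume *: "i + j + k = 3"
  then have "i \<in> {0, 1, 2, 3}" "j \<in> {0, 1, 2, 3}" "k = 3 - (i + j)" by auto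
  then show "(i, j, k) \<in> cubic_exponents"
    using * by (elim insertE emptyE) (simp_all add: cubic_exponents_def)
qed (auto simp: cubic_exponents_def)

text \<open>Harmonicity is left out on purpose: the condition is then linear in the coefficients,
  and identities can be checked on each of the ten monomials.\<close>

definition cubic_form :: "(real^3 \<Rightarrow> real) \<Rightarrow> bool" where
  "cubic_form h \<longleftrightarrow> (\<exists>c. h = (\<lambda>v. \<Sum>m\<in>cubic_exponents. c m * monomial3 m v))"

lemma cubic_form_zero: "cubic_form (\<lambda>v. 0)"
  unfolding cubic_form_def by (intro exI[of _ "\<lambda>_. 0"]) simp

lemma cubic_form_add:
  assumes "cubic_form f" "cubic_form g"
  shows "cubic_form (\<lambda>v. f v + g v)"
proof -
  obtain c d where "f = (\<lambda>v. \<Sum>m\<in>cubic_exponents. c m * monomial3 m v)"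
    "g = (\<lambda>v. \<Sum>m\<in>cubic_exponents. d m * monomial3 m v)"
    using assms unfolding cubic_form_def by blast
  then show ?thesis
    unfolding cubic_form_def
    by (intro exI[of _ "\<lambda>m. c m + d m"]) (simp add: distrib_right sum.distrib)
qed

lemma cubic_form_monomial:
  assumes "i + j + k = 3"
  shows "cubic_form (\<lambda>v. c * v$1^i * v$2^j * v$3^k)"
proof -
  have "(\<Sum>m\<in>cubic_exponents. (if m = (i, j, k) then c else 0) * monomial3 m v)
      = (\<Sum>m\<in>{(i, j, k)}. (if m = (i, j, k) then c else 0) * monomial3 m v)" for v
    using assms cubic_exponents_iff[of i j k]
    by (intro sum.mono_neutral_right) (auto simp: cubic_exponents_def)
  then show ?thesis
    unfolding cubic_form_def
    by (intro exI[of _ "\<lambda>m. if m = (i, j, k) then c else 0"]) (simp add: monomial3_def mult.assoc)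
qed

lemma cubic_formE:
  assumes "cubic_form h"
  obtains a b c d e f g i j k where "h = (\<lambda>v. a * v$1^3 + b * v$2^3 + c * v$3^3
     + d * v$1^2 * v$2 + e * v$1^2 * v$3 + f * v$1 * v$2^2 + g * v$2^2 * v$3
     + i * v$1 * v$3^2 + j * v$2 * v$3^2 + k * v$1 * v$2 * v$3)"
proof -
  obtain c where "h = (\<lambda>v. \<Sum>m\<in>cubic_exponents. c m * monomial3 m v)"
    using assms unfolding cubic_form_def by blast
  then show ?thesis
    by (intro that[of "c (3,0,0)" "c (0,3,0)" "c (0,0,3)" "c (2,1,0)" "c (2,0,1)" "c (1,2,0)"
          "c (0,2,1)" "c (1,0,2)" "c (0,1,2)" "c (1,1,1)"])
      (simp add: cubic_exponents_def monomial3_def add.assoc mult.assoc)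
qed

text \<open>Lists may repeat exponents, so sums are appends and products are comprehensions, with no
  collecting of like terms.\<close>

definition monomial_sum :: "(real \<times> nat \<times> nat \<times> nat) list \<Rightarrow> real^3 \<Rightarrow> real" where
  "monomial_sum L v = (\<Sum>(c, i, j, k)\<leftarrow>L. c * v$1^i * v$2^j * v$3^k)"

lemma monomial_sum_mult:
  "monomial_sum L v * monomial_sum M v =
     monomial_sum [(c * c', i + i', j + j', k + k'). (c, i, j, k) \<leftarrow> L, (c', i', j', k') \<leftarrow> M] v"
proof (induction L)
  case (Cons m L)
  obtain c i j k where m: "m = (c, i, j, k)" by (cases m)
  have "c * v$1^i * v$2^j * v$3^k * monomial_sum M v =
      monomial_sum [(c * c', i + i', j + j', k + k'). (c', i', j', k') \<leftarrow> M] v"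
    by (induction M) (auto simp: monomial_sum_def algebra_simps power_add)
  with Cons show ?case
    by (simp add: m monomial_sum_def distrib_right)
qed (simp add: monomial_sum_def)

lemma real_polynomial_function_monomial_sum:
  assumes "real_polynomial_function h"
  shows "\<exists>L. h = monomial_sum L"
  using assms
proof induction
  case (linear f)
  have "f v = monomial_sum [(f (axis 1 1), 1, 0, 0), (f (axis 2 1), 0, 1, 0), (f (axis 3 1), 0, 0, 1)] v" for v
  proof -
    have "v = v$1 *\<^sub>R axis 1 1 + v$2 *\<^sub>R axis 2 1 + v$3 *\<^sub>R axis 3 1"
      by (simp add: vec_eq_iff forall_3 axis_def)
    then have "f v = f (v$1 *\<^sub>R axis 1 1 + v$2 *\<^sub>R axis 2 1 + v$3 *\<^sub>R axis 3 1)" by simp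
    also have "\<dots> = v$1 * f (axis 1 1) + v$2 * f (axis 2 1) + v$3 * f (axis 3 1)"
      using linear by (simp add: bounded_linear.linear linear_add linear_scale)
    finally show ?thesis by (simp add: monomial_sum_def)
  qed
  then show ?case by blast
next
  case (const c)
  have "(\<lambda>v. c) = monomial_sum [(c, 0, 0, 0)]"
    by (simp add: monomial_sum_def fun_eq_iff)
  then show ?case by blast
next
  case (add f g)
  then obtain L M where "f = monomial_sum L" "g = monomial_sum M" by blast
  then have "(\<lambda>v. f v + g v) = monomial_sum (L @ M)"
    by (simp add: monomial_sum_def fun_eq_iff)
  then show ?case by blast
next
  case (mult f g)
  then show ?case using monomial_sum_mult by blast
qed

lemma homogeneous_cubic_form:
  assumes "real_polynomial_function h" "\<And>c v. h (c *\<^sub>R v) = c ^ 3 * h v"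
  shows "cubic_form h"
proof -
  obtain L where L: "h = monomial_sum L"
    using real_polynomial_function_monomial_sum[OF assms(1)] by blast
  \<comment> \<open>\<open>P v\<close> is the polynomial \<open>t \<mapsto> h (t v)\<close>.
    Homogeneity forces it to be \<open>h v * t^3\<close>, so \<open>h v\<close> is its coefficient
    at degree 3, which only receives the monomials of total degree 3.\<close>
  define P where "P v = (\<Sum>(c, i, j, k)\<leftarrow>L. Polynomial.monom (c * v$1^i * v$2^j * v$3^k) (i + j + k))" for v :: "real^3"
  have P: "poly (P v) t = h (t *\<^sub>R v)" for v t
    unfolding P_def L monomial_sum_def
    by (induction L) (auto simp: poly_monom power_add power_mult_distrib algebra_simps)
  have "P v = Polynomial.monom (h v) 3" for v
    by (simp add: P assms(2) poly_monom fun_eq_iff mult.commute flip: poly_eq_poly_eq_iff)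
  then have "h v = Polynomial.coeff (P v) 3" for v by simp
  moreover have "cubic_form (\<lambda>v. Polynomial.coeff (P v) 3)"
    unfolding P_def
  proof (induction L)
    case (Cons m L)
    obtain c i j k where m: "m = (c, i, j, k)" by (cases m)
    show ?case
      using Cons.IH cubic_form_monomial[of i j k c] cubic_form_zero
      by (cases "i + j + k = 3") (simp_all add: m cubic_form_add)
  qed (simp add: cubic_form_zero)
  ultimately show ?thesis by presburger
qed

section \<open>The Hessian of a cubic form\<close>

text \<open>The full polarization: for a cubic form this is the symmetric trilinear form with value
  \<open>6 * h v\<close> on the diagonal, that is, the third derivative. Fixing one argument
  therefore gives the Hessian at that point.\<close>

definition polar3 :: "('a::plus \<Rightarrow> real) \<Rightarrow> 'a \<Rightarrow> 'a \<Rightarrow> 'a \<Rightarrow> real" where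
  "polar3 h u v w = h (u + v + w) - h (u + v) - h (u + w) - h (v + w) + h u + h v + h w"

definition hess :: "(real^3 \<Rightarrow> real) \<Rightarrow> real^3 \<Rightarrow> real^3^3" where
  "hess h v = (\<chi> i j. polar3 h v (axis i 1) (axis j 1))"

lemma polar3_monomial3:
  assumes "m \<in> cubic_exponents"
  shows "polar3 (monomial3 m) v a b = a \<bullet> (hess (monomial3 m) v *v b)"
  using assms unfolding cubic_exponents_def
  by (elim insertE emptyE;
      simp add: polar3_def hess_def monomial3_def inner_vec_def matrix_vector_mult_def sum_3 axis_def
        power2_eq_square power3_eq_cube algebra_simps)

text \<open>Trilinearity of the polarization, for arbitrary directions and not only for basis
  vectors. Both sides are linear in the coefficients, which reduces the claim to monomials.\<close>

lemma polar3_hess: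
  assumes "cubic_form h"
  shows "polar3 h v a b = a \<bullet> (hess h v *v b)"
proof -
  obtain c where h: "h = (\<lambda>v. \<Sum>m\<in>cubic_exponents. c m * monomial3 m v)"
    using assms unfolding cubic_form_def by blast
  have p: "polar3 h u a b = (\<Sum>m\<in>cubic_exponents. c m * polar3 (monomial3 m) u a b)" for u a b
    by (simp add: h polar3_def ring_distribs sum.distrib sum_subtractf)
  have "a \<bullet> (hess h v *v b) = (\<Sum>m\<in>cubic_exponents. c m * (a \<bullet> (hess (monomial3 m) v *v b)))"
    by (simp add: hess_def p inner_vec_def matrix_vector_mult_def sum_3)
      (simp only: sum_distrib_left sum_distrib_right flip: sum.distrib, simp add: algebra_simps)
  then show ?thesis
    by (simp add: p polar3_monomial3)
qed

text \<open>The bridge from the analytic \<open>laplacian\<close> to polarization. Once derivatives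
  are computed here, harmonicity becomes the vanishing of the trace of \<open>hess\<close>.\<close>

lemma partial_partial_cubic_form:
  assumes "cubic_form h"
  shows "partial i (partial i h) v = polar3 h v (axis i 1) (axis i 1)"
proof -
  obtain a b c d e f g k l m where h: "h = (\<lambda>v. a * v$1^3 + b * v$2^3 + c * v$3^3
     + d * v$1^2 * v$2 + e * v$1^2 * v$3 + f * v$1 * v$2^2 + g * v$2^2 * v$3
     + k * v$1 * v$3^2 + l * v$2 * v$3^2 + m * v$1 * v$2 * v$3)"
    using assms by (rule cubic_formE)
  consider "i = 1" | "i = 2" | "i = 3" using exhaust_3 by blast
  then show ?thesis
  proof cases
    case 1
    have "partial i h = (\<lambda>v. 3 * a * v$1^2 + 2 * d * v$1 * v$2 + 2 * e * v$1 * v$3 + f * v$2^2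
        + k * v$3^2 + m * v$2 * v$3)"
      unfolding h 1 partial_def
      by (rule ext, rule DERIV_imp_deriv) (auto intro!: derivative_eq_intros simp: axis_def)
    then have "partial i (partial i h) v = 6 * a * v$1 + 2 * d * v$2 + 2 * e * v$3"
      unfolding 1 by (simp only:) (unfold partial_def,
        rule DERIV_imp_deriv, auto intro!: derivative_eq_intros simp: axis_def)
    then show ?thesis
      by (simp add: h 1 polar3_def axis_def power2_eq_square power3_eq_cube algebra_simps)
  next
    case 2
    have "partial i h = (\<lambda>v. 3 * b * v$2^2 + d * v$1^2 + 2 * f * v$1 * v$2 + 2 * g * v$2 * v$3
        + l * v$3^2 + m * v$1 * v$3)"
      unfolding h 2 partial_def
      by (rule ext, rule DERIV_imp_deriv) (auto intro!: derivative_eq_intros simp: axis_def)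
    then have "partial i (partial i h) v = 6 * b * v$2 + 2 * f * v$1 + 2 * g * v$3"
      unfolding 2 by (simp only:) (unfold partial_def,
        rule DERIV_imp_deriv, auto intro!: derivative_eq_intros simp: axis_def)
    then show ?thesis
      by (simp add: h 2 polar3_def axis_def power2_eq_square power3_eq_cube algebra_simps)
  next
    case 3
    have "partial i h = (\<lambda>v. 3 * c * v$3^2 + e * v$1^2 + g * v$2^2 + 2 * k * v$1 * v$3
        + 2 * l * v$2 * v$3 + m * v$1 * v$2)"
      unfolding h 3 partial_def
      by (rule ext, rule DERIV_imp_deriv) (auto intro!: derivative_eq_intros simp: axis_def)
    then have "partial i (partial i h) v = 6 * c * v$3 + 2 * k * v$1 + 2 * l * v$2"
      unfolding 3 by (simp only:) (unfold partial_def,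
        rule DERIV_imp_deriv, auto intro!: derivative_eq_intros simp: axis_def)
    then show ?thesis
      by (simp add: h 3 polar3_def axis_def power2_eq_square power3_eq_cube algebra_simps)
  qed
qed

lemma laplacian_cubic_form: "cubic_form h \<Longrightarrow> laplacian h v = trace (hess h v)"
  by (simp add: laplacian_def partial_partial_cubic_form trace_def hess_def)

lemma inner_transpose: "(A *v a) \<bullet> w = a \<bullet> (transpose A *v w)" for A :: "real^'n^'m"
  using dot_lmul_matrix[of a "transpose A" w] by (simp flip: transpose_matrix_vector)

text \<open>Polarization uses only sums and values of \<open>h\<close>, so it commutes with the
  linear map \<open>A\<close>; bilinearity in the two directions then moves \<open>A\<close> to both
  sides of the matrix.\<close>

lemma hess_pullback:
  assumes "cubic_form h"
  shows "hess (pullback A h) v = transpose A ** hess h (A *v v) ** A"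
proof -
  have "hess (pullback A h) v $ i $ j = (transpose A ** hess h (A *v v) ** A) $ i $ j" for i j
  proof -
    have "hess (pullback A h) v $ i $ j = polar3 h (A *v v) (A *v axis i 1) (A *v axis j 1)"
      by (simp add: hess_def polar3_def pullback_def matrix_vector_right_distrib)
    also have "\<dots> = (A *v axis i 1) \<bullet> (hess h (A *v v) *v (A *v axis j 1))"
      by (simp add: polar3_hess assms)
    also have "\<dots> = axis i 1 \<bullet> ((transpose A ** hess h (A *v v) ** A) *v axis j 1)"
      by (simp add: inner_transpose matrix_vector_mul_assoc matrix_mul_assoc)
    also have "\<dots> = (transpose A ** hess h (A *v v) ** A) $ i $ j"
      by (simp add: inner_axis' matrix_vector_mul_component inner_axis)
    finally show ?thesis .
  qed
  then show ?thesis by (simp add: vec_eq_iff)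
qed

lemma trace_conjugate: "rotation_matrix A \<Longrightarrow> trace (transpose A ** M ** A) = trace M"
  for A M :: "real^'n^'n"
  by (simp add: trace_mul_sym[of "transpose A"] rotation_matrix_inverse flip: matrix_mul_assoc)

lemma harmonic_homogeneous_cubic_form: "h \<in> harmonic_homogeneous 3 \<Longrightarrow> cubic_form h"
  by (simp add: harmonic_homogeneous_def homogeneous_cubic_form)

lemma harmonic_homogeneous_pullback:
  fixes R :: "real^3^3"
  assumes "h \<in> harmonic_homogeneous 3" "rotation_matrix R"
  shows "pullback R h \<in> harmonic_homogeneous 3"
proof -
  have h: "real_polynomial_function h" "\<And>c v. h (c *\<^sub>R v) = c^3 * h v" "\<And>v. laplacian h v = 0"
    using assms(1) by (auto simp: harmonic_homogeneous_def)
  have "pullback R h = h \<circ> (*v) R" by (simp add: fun_eq_iff pullback_def)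
  moreover have "polynomial_function ((*v) R)"
    by (intro polynomial_function_bounded_linear linear_conv_bounded_linear[THEN iffD1] matrix_vector_mul_linear)
  ultimately have 1: "real_polynomial_function (pullback R h)"
    using real_polynomial_function_compose h(1) by metis
  have 2: "pullback R h (c *\<^sub>R v) = c^3 * pullback R h v" for c v
    by (simp add: pullback_def matrix_vector_mult_scaleR h(2))
  have "laplacian (pullback R h) v = 0" for v
    using h(3) harmonic_homogeneous_cubic_form[OF assms(1)] homogeneous_cubic_form[OF 1 2] assms(2)
    by (simp add: laplacian_cubic_form hess_pullback trace_conjugate)
  with 1 2 show ?thesis by (simp add: harmonic_homogeneous_def)
qed

section \<open>Weight decomposition under rotations about the third axis\<close>

abbreviation hor :: "real^3 \<Rightarrow> complex" where "hor v \<equiv> Complex (v$1) (v$2)"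

definition wform :: "real \<Rightarrow> complex \<Rightarrow> complex \<Rightarrow> complex \<Rightarrow> real^3 \<Rightarrow> real" where
  "wform a b c d v = a * (2 * v$3^3 - 3 * v$3 * (cmod (hor v))^2)
     + Re (b * hor v) * (4 * v$3^2 - (cmod (hor v))^2)
     + v$3 * Re (c * hor v^2) + Re (d * hor v^3)"

lemma wform_expand:
  "wform a b c d v = a * (2 * v$3^3 - 3 * v$3 * (v$1^2 + v$2^2))
     + (Re b * v$1 - Im b * v$2) * (4 * v$3^2 - (v$1^2 + v$2^2))
     + v$3 * (Re c * (v$1^2 - v$2^2) - 2 * Im c * v$1 * v$2)
     + (Re d * (v$1^3 - 3 * v$1 * v$2^2) - Im d * (3 * v$1^2 * v$2 - v$2^3))"
proof -
  have "Re (c * hor v^2) = Re c * (v$1^2 - v$2^2) - 2 * Im c * v$1 * v$2"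
    by (simp add: power2_eq_square algebra_simps)
  moreover have "Re (d * hor v^3) = Re d * (v$1^3 - 3 * v$1 * v$2^2) - Im d * (3 * v$1^2 * v$2 - v$2^3)"
    by (simp add: power2_eq_square power3_eq_cube algebra_simps)
  ultimately show ?thesis by (simp add: wform_def cmod_power2)
qed

lemma wform_eq_iff: "wform a b c d = wform a' b' c' d' \<longleftrightarrow> a = a' \<and> b = b' \<and> c = c' \<and> d = d'"
proof
  assume *: "wform a b c d = wform a' b' c' d'"
  have v: "wform a b c d (vector [x, y, z]) = wform a' b' c' d' (vector [x, y, z])" for x y z
    by (simp add: *)
  \<comment> \<open>These evaluations determine the seven real coefficients \<open>a\<close>,
    \<open>Re b\<close>, \<open>Im b\<close>, \<open>Re c\<close>, \<open>Im c\<close>,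
    \<open>Re d\<close>, \<open>Im d\<close>.\<close>
  note * = v[of 0 0 1] v[of 1 0 0] v[of 1 0 1] v[of 1 0 "-1"] v[of 0 1 0] v[of 0 1 1] v[of 1 1 1] v[of 1 1 "-1"]
  show "a = a' \<and> b = b' \<and> c = c' \<and> d = d'"
    using * by (simp add: wform_expand complex_eq_iff)
qed auto

lemma harmonic_homogeneous_imp_wform:
  assumes "h \<in> harmonic_homogeneous 3"
  obtains a b c d where "h = wform a b c d"
proof -
  have cf: "cubic_form h" using assms by (rule harmonic_homogeneous_cubic_form)
  then obtain a b c d e f g k l m where h: "h = (\<lambda>v. a * v$1^3 + b * v$2^3 + c * v$3^3
     + d * v$1^2 * v$2 + e * v$1^2 * v$3 + f * v$1 * v$2^2 + g * v$2^2 * v$3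
     + k * v$1 * v$3^2 + l * v$2 * v$3^2 + m * v$1 * v$2 * v$3)"
    by (rule cubic_formE)
  have "trace (hess h v) = 0" for v
    using assms laplacian_cubic_form[OF cf] by (simp add: harmonic_homogeneous_def)
  \<comment> \<open>The Laplacian of a cubic is linear in \<open>v\<close>, so three basis vectors
    carry all of harmonicity. They eliminate three of the ten coefficients and leave the seven of
    \<open>wform\<close>.\<close>
  from this[of "axis 1 1"] this[of "axis 2 1"] this[of "axis 3 1"]
  have fdg: "f = - 3 * a - k" "d = - 3 * b - l" "g = - 3 * c - e"
    by (simp_all add: trace_def hess_def sum_3 polar3_def h axis_def)
  have "h v = wform (c / 2) (Complex (k / 4) (- l / 4)) (Complex (e + 3 * c / 2) (- m / 2))
      (Complex (a + k / 4) (b + l / 4)) v" for v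
    unfolding h fdg wform_expand by (simp add: power2_eq_square power3_eq_cube field_simps)
  then have "h = wform (c / 2) (Complex (k / 4) (- l / 4)) (Complex (e + 3 * c / 2) (- m / 2))
      (Complex (a + k / 4) (b + l / 4))" by blast
  then show ?thesis by (rule that)
qed

lemma cubic_eq_wform:
  "cubic Form_SO3 = wform 0 0 0 0"
  "cubic (Form_SO2 r) = wform r 0 0 0"
  "cubic (Form_A4 s) = wform 0 0 (- 3 * \<i> * s) 0"
  "cubic (Form_S3 s) = wform 0 0 0 s"
  "cubic (Form_Z2 r s) = wform r 0 (- 3 * \<i> * s) 0"
  "cubic (Form_Z3 r s) = wform r 0 0 s"
  by (simp_all add: fun_eq_iff wform_expand cubic_SO2_def cubic_A4_def cubic_S3_def Let_def algebra_simps)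

section \<open>Explicit rotations and their action on the weight decomposition\<close>

definition rotz :: "complex \<Rightarrow> real^3^3" where
  "rotz w = vector [vector [Re w, - Im w, 0], vector [Im w, Re w, 0], vector [0, 0, 1]]"

definition diag3 :: "real \<Rightarrow> real \<Rightarrow> real \<Rightarrow> real^3^3" where
  "diag3 a b c = vector [vector [a, 0, 0], vector [0, b, 0], vector [0, 0, c]]"

definition cyc :: "real^3^3" where
  "cyc = vector [vector [0, 0, 1], vector [1, 0, 0], vector [0, 1, 0]]"

text \<open>The half turn about the \<open>x\<close>-axis: complex conjugation on the horizontal
  plane together with reversal of \<open>z\<close>.\<close>

abbreviation flip :: "real^3^3" where "flip \<equiv> diag3 1 (- 1) (- 1)"

lemmas mat3_simps = vec_eq_iff forall_3 sum_3 matrix_matrix_mult_def matrix_vector_mult_def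
  transpose_def mat_def

lemma rotz_apply [simp]:
  "(rotz w *v v)$1 = Re w * v$1 - Im w * v$2"
  "(rotz w *v v)$2 = Im w * v$1 + Re w * v$2"
  "(rotz w *v v)$3 = v$3"
  by (simp_all add: rotz_def matrix_vector_mult_def sum_3)

lemma diag3_apply [simp]:
  "(diag3 a b c *v v)$1 = a * v$1" "(diag3 a b c *v v)$2 = b * v$2" "(diag3 a b c *v v)$3 = c * v$3"
  by (simp_all add: diag3_def matrix_vector_mult_def sum_3)

lemma cyc_apply [simp]:
  "(cyc *v v)$1 = v$3" "(cyc *v v)$2 = v$1" "(cyc *v v)$3 = v$2"
  by (simp_all add: cyc_def matrix_vector_mult_def sum_3)

lemma rotz_mult: "rotz w ** rotz w' = rotz (w * w')"
  by (simp add: mat3_simps rotz_def algebra_simps)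

lemma rotz_one: "rotz 1 = mat 1"
  by (simp add: mat3_simps rotz_def)

lemma rotz_eq_iff [simp]: "rotz w = rotz w' \<longleftrightarrow> w = w'"
  by (auto simp: mat3_simps rotz_def complex_eq_iff)

lemma diag3_mult: "diag3 a b c ** diag3 a' b' c' = diag3 (a * a') (b * b') (c * c')"
  by (simp add: mat3_simps diag3_def)

lemma diag3_one: "diag3 1 1 1 = mat 1"
  by (simp add: mat3_simps diag3_def)

lemma rotation_matrix_rotz: "cmod w = 1 \<Longrightarrow> rotation_matrix (rotz w)"
  using cmod_power2[of w]
  by (simp add: rotation_matrix_def orthogonal_matrix_def det_3 mat3_simps rotz_def power2_eq_square mult.commute)

lemma rotation_matrix_diag3: "{a, b, c} \<subseteq> {1, - 1} \<Longrightarrow> a * b * c = 1 \<Longrightarrow> rotation_matrix (diag3 a b c)"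
  by (auto simp: rotation_matrix_def orthogonal_matrix_def det_3 mat3_simps diag3_def)

lemma rotation_matrix_cyc: "rotation_matrix cyc"
  by (simp add: rotation_matrix_def orthogonal_matrix_def det_3 mat3_simps cyc_def)

lemma rotation_matrix_flip: "rotation_matrix flip"
  by (rule rotation_matrix_diag3) auto

lemma wform_rotz:
  assumes "cmod w = 1"
  shows "wform a b c d (rotz w *v v) = wform a (b * w) (c * w^2) (d * w^3) v"
proof -
  have "Complex (Re w * v$1 - Im w * v$2) (Im w * v$1 + Re w * v$2) = w * hor v"
    by (simp add: complex_eq_iff)
  then show ?thesis
    using assms by (simp add: wform_def norm_mult power_mult_distrib mult.assoc)
qed

text \<open>Conjugating the horizontal variable conjugates \<open>b\<close>, \<open>c\<close>,
  \<open>d\<close>; reversing \<open>z\<close> changes the sign of the two terms odd in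
  \<open>z\<close>, those of \<open>a\<close> and \<open>c\<close>.\<close>

lemma wform_flip: "wform a b c d (flip *v v) = wform (- a) (cnj b) (- cnj c) (cnj d) v"
proof -
  have "Complex (v$1) (- v$2) = cnj (hor v)" by (simp add: complex_eq_iff)
  moreover have "Re (x * cnj y) = Re (cnj x * y)" for x y by simp
  ultimately show ?thesis
    by (simp add: wform_def flip: complex_cnj_power del: times_complex.sel) (simp add: algebra_simps)
qed

lemma axis_3_fixed_iff: "A *v z_axis = z_axis \<longleftrightarrow> A$1$3 = 0 \<and> A$2$3 = 0 \<and> A$3$3 = 1"
  by (simp add: mat3_simps axis_def)

lemma rotation_fixing_z:
  assumes "rotation_matrix g" "g$3$3 = 1"
  obtains w where "cmod w = 1" "g = rotz w"
proof -
  note R = rotation_matrix_entries[OF assms(1)]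
  have sq: "x = 0 \<and> y = 0" if "x * x + y * y = 0" for x y :: real
    using that by (simp add: sum_squares_eq_zero_iff)
  have col: "g$1$3 = 0 \<and> g$2$3 = 0" using R(1)[of 3 3] assms(2) by (intro sq) simp
  have row: "g$3$1 = 0 \<and> g$3$2 = 0" using R(2)[of 3 3] assms(2) by (intro sq) simp
  have det: "g$1$1 * g$2$2 - g$1$2 * g$2$1 = 1"
    using assms col row by (simp add: rotation_matrix_def det_3)
  \<comment> \<open>For a 2 by 2 block this sum of squares is the sum of all squared entries minus
    twice the determinant, here \<open>2 - 2\<close>. Its vanishing says that the block is
    multiplication by a complex number.\<close>
  have "(g$1$1 - g$2$2) * (g$1$1 - g$2$2) + (g$1$2 + g$2$1) * (g$1$2 + g$2$1) = 0"
    using det R(1)[of 1 1] R(1)[of 2 2] row by (simp add: algebra_simps)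
  then have "g$2$2 = g$1$1" "g$1$2 = - g$2$1" by (auto dest: sq)
  then have "g = rotz (Complex (g$1$1) (g$2$1))"
    using col row assms(2) by (simp add: rotz_def vec_eq_iff forall_3)
  moreover have "cmod (Complex (g$1$1) (g$2$1)) = 1"
    using R(1)[of 1 1] row by (simp add: cmod_def power2_eq_square)
  ultimately show ?thesis using that by blast
qed

text \<open>The hypotheses say that \<open>g\<close> preserves the \<open>z\<close>-axis as a line.
  If \<open>g\<close> reverses it, composing with \<open>flip\<close> reduces to a rotation fixing
  it pointwise.\<close>

lemma rotation_z_line:
  assumes "rotation_matrix g" "g$1$3 = 0" "g$2$3 = 0"
  obtains w where "cmod w = 1" "g = rotz w" | w where "cmod w = 1" "g = rotz w ** flip"
proof -
  have "g$3$3 * g$3$3 = 1" using rotation_matrix_entries(1)[OF assms(1), of 3 3] assms by simp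
  then consider "g$3$3 = 1" | "g$3$3 = - 1" by (metis square_eq_1_iff)
  then show ?thesis
  proof cases
    case 2
    then have "(g ** flip)$3$3 = 1" by (simp add: mat3_simps diag3_def)
    then obtain w where w: "cmod w = 1" "g ** flip = rotz w"
      using rotation_fixing_z rotation_matrix_mult rotation_matrix_flip assms(1) by metis
    have "g = g ** flip ** flip"
      by (simp add: diag3_mult diag3_one flip: matrix_mul_assoc)
    then show ?thesis using w that(2) by metis
  qed (use rotation_fixing_z assms that in metis)
qed

section \<open>Matrices of the rotations named in the theorem\<close>

lemma sgn_axis [simp]: "sgn (axis i 1 :: real^'n) = axis i 1"
  by (simp add: sgn_div_norm norm_axis_1)

lemma rotation_about_apply:
  assumes "sgn u = n"
  shows "rotation_about u \<theta> *v v =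
    cos \<theta> *\<^sub>R v + sin \<theta> *\<^sub>R cross3 n v + ((1 - cos \<theta>) * (n \<bullet> v)) *\<^sub>R n"
proof -
  have "linear (\<lambda>v. cos \<theta> *\<^sub>R v + sin \<theta> *\<^sub>R cross3 n v + ((1 - cos \<theta>) * (n \<bullet> v)) *\<^sub>R n)"
    by (rule linearI) (simp_all add: cross_add_right cross_mult_right algebra_simps)
  then show ?thesis
    by (simp add: rotation_about_def assms Let_def matrix_works)
qed

lemma rotation_about_z: "rotation_about z_axis \<theta> = rotz (cis \<theta>)"
  by (simp add: matrix_eq rotation_about_apply[OF sgn_axis] inner_axis')
    (simp add: vec_eq_iff forall_3 cross3_def axis_def algebra_simps)

lemma rotation_about_pi:
  "rotation_about x_axis pi = diag3 1 (- 1) (- 1)"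
  "rotation_about y_axis pi = diag3 (- 1) 1 (- 1)"
  "rotation_about z_axis pi = diag3 (- 1) (- 1) 1"
  by (simp_all add: matrix_eq rotation_about_apply[OF sgn_axis] inner_axis')
    (simp_all add: vec_eq_iff forall_3 axis_def)

lemma rotation_about_111: "rotation_about (vector [1, 1, 1]) (2/3 * pi) = cyc"
proof -
  have n: "sgn (vector [1, 1, 1] :: real^3) = vector [1 / sqrt 3, 1 / sqrt 3, 1 / sqrt 3]"
    by (simp add: sgn_div_norm norm_eq_sqrt_inner inner_vec_def sum_3 vec_eq_iff forall_3 divide_inverse)
  have *: "cos (2/3 * pi) = - 1/2" "sin (2/3 * pi) = sqrt 3 / 2"
    using cos_120 sin_120 by (simp_all add: mult.commute)
  have **: "sqrt 3 * (sqrt 3 * x) = 3 * x" for x :: real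
    by (simp flip: mult.assoc)
  show ?thesis
    unfolding matrix_eq rotation_about_apply[OF n] *
    by (simp add: vec_eq_iff forall_3 cross3_def inner_vec_def sum_3 field_simps **)
qed

section \<open>Stabilizers of forms with a distinguished axis\<close>

lemma cubic_form_wform: "cubic_form (wform a b c d)"
proof (rule homogeneous_cubic_form)
  have [intro]: "real_polynomial_function (\<lambda>v::real^3. v$i)" for i
    by (intro real_polynomial_function.intros(1) bounded_linear_vec_nth)
  show "real_polynomial_function (wform a b c d)"
    unfolding wform_expand[abs_def]
    by (intro real_polynomial_function.intros(2-4)
        real_polynomial_function_diff real_polynomial_function_power) auto
  show "wform a b c d (t *\<^sub>R v) = t^3 * wform a b c d v" for t v
    by (simp add: wform_expand power2_eq_square power3_eq_cube algebra_simps)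
qed

text \<open>For \<open>g\<close> in the stabilizer the Hessians at \<open>v\<close> and at
  \<open>g v\<close> are conjugate by \<open>g\<close>, the same matrix for every \<open>v\<close>,
  so traces of products agree.\<close>

lemma trace_hess_stab:
  assumes "cubic_form h" "g \<in> stab h"
  shows "trace (hess h (g *v u) ** hess h (g *v v)) = trace (hess h u ** hess h v)"
proof -
  have g: "rotation_matrix g" and "pullback g h = h"
    using assms(2) by (auto simp: stabilizer_def)
  then have "hess h v = transpose g ** hess h (g *v v) ** g" for v
    using hess_pullback[OF assms(1), of g v] by simp
  then have "hess h u ** hess h v =
      transpose g ** hess h (g *v u) ** g ** (transpose g ** hess h (g *v v) ** g)"
    by metis
  also have "\<dots> = transpose g ** (hess h (g *v u) ** hess h (g *v v)) ** g"
    using g by (simp add: rotation_matrix_cancel flip: matrix_mul_assoc)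
  finally show ?thesis using g by (simp add: trace_conjugate)
qed

lemma hess_Z2:
  "hess (wform r 0 (- 3 * \<i> * of_real s) 0) v = 6 *\<^sub>R vector [
     vector [- r * v$3, s * v$3, s * v$2 - r * v$1],
     vector [s * v$3, - r * v$3, s * v$1 - r * v$2],
     vector [s * v$2 - r * v$1, s * v$1 - r * v$2, 2 * r * v$3]]"
  by (simp add: vec_eq_iff forall_3 hess_def polar3_def wform_expand axis_def)
    (simp add: power2_eq_square power3_eq_cube algebra_simps)

lemma hess_Z3:
  "hess (wform r 0 0 (of_real s)) v = 6 *\<^sub>R vector [
     vector [s * v$1 - r * v$3, - s * v$2, - r * v$1],
     vector [- s * v$2, - s * v$1 - r * v$3, - r * v$2],
     vector [- r * v$1, - r * v$2, 2 * r * v$3]]"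
  by (simp add: vec_eq_iff forall_3 hess_def polar3_def wform_expand axis_def)
    (simp add: power2_eq_square power3_eq_cube algebra_simps)

lemma trace_hess_Z2:
  fixes r s defines "h \<equiv> wform r 0 (- 3 * \<i> * of_real s) 0"
  shows "trace (hess h u ** hess h v) = 72 * (r^2 + s^2) * (u \<bullet> v)
    + 144 * r^2 * (u$3 * v$3) - 144 * r * s * (u$1 * v$2 + u$2 * v$1)"
  unfolding h_def hess_Z2 by (simp add: trace_def matrix_matrix_mult_def sum_3 inner_vec_def)
    (simp add: power2_eq_square algebra_simps)

lemma trace_hess_Z3:
  fixes r s defines "h \<equiv> wform r 0 0 (of_real s)"
  shows "trace (hess h u ** hess h v) = 72 * (r^2 + s^2) * (u \<bullet> v)
    + 72 * (2 * r^2 - s^2) * (u$3 * v$3)"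
  unfolding h_def hess_Z3 by (simp add: trace_def matrix_matrix_mult_def sum_3 inner_vec_def)
    (simp add: power2_eq_square algebra_simps)

text \<open>The hypotheses on \<open>q\<close> and \<open>t\<close> make the \<open>z\<close>-axis a simple eigenspace of the invariant
  quadratic form.\<close>
lemma invariant_form_z_line:
  assumes "rotation_matrix g" "q \<noteq> 0" "q^2 \<noteq> t^2"
    and B: "\<And>u v :: real^3. B u v = p * (u \<bullet> v) + q * (u$3 * v$3) + t * (u$1 * v$2 + u$2 * v$1)"
    and inv: "\<And>u v. B (g *v u) (g *v v) = B u v"
  shows "g$1$3 = 0" "g$2$3 = 0"
proof -
  have B': "B (axis i 1) (g *v axis 3 1) = B (transpose g *v axis i 1) (axis 3 1)" for i
    using inv[of "transpose g *v axis i 1" "axis 3 1"] by (simp add: rotation_matrix_cancel assms(1))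
  have I: "axis i 1 \<bullet> (g *v axis 3 1) = (transpose g *v axis i 1) \<bullet> axis 3 1" for i
    by (simp add: inner_transpose)
  have g: "g *v axis 3 1 = (\<chi> i. g$i$3)" "transpose g *v axis i 1 = g$i" for i
    by (simp_all add: mat3_simps axis_def if_distrib cong: if_cong) (metis exhaust_3 one_neq_zero)
  \<comment> \<open>Invariance compares \<open>g\<close> applied to \<open>z_axis\<close> with the
    rows of \<open>g\<close>; the \<open>p\<close> terms cancel. The equations for
    \<open>i = 1\<close> and \<open>i = 2\<close> form a linear system in \<open>g$1$3\<close> and
    \<open>g$2$3\<close> with determinant \<open>q^2 - t^2\<close> up to sign.\<close>
  have 1: "t * g$2$3 = q * g$1$3"
    using B'[of 1] I[of 1] unfolding B g by (simp add: axis_def)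
  have 2: "t * g$1$3 = q * g$2$3"
    using B'[of 2] I[of 2] unfolding B g by (simp add: axis_def)
  have "(q^2 - t^2) * g$1$3 = q * (q * g$1$3) - t * (t * g$1$3)"
    by (simp add: power2_eq_square algebra_simps)
  also have "\<dots> = 0" unfolding 2 by (simp flip: 1)
  finally show "g$1$3 = 0" using assms(3) by simp
  then show "g$2$3 = 0" using 2 assms(2) by simp
qed

text \<open>The eigenvalues of the covariant are \<open>p + q\<close> on the \<open>z\<close>-axis
  and \<open>p + t\<close>, \<open>p - t\<close> on the horizontal diagonals, with
  \<open>q = 144 * r^2\<close> and \<open>t = - 144 * r * s\<close>. Taking \<open>s = 0\<close>
  serves the \<open>SO2\<close> form as well.\<close>

lemma z_line_Z2:
  assumes "g \<in> stab (wform r 0 (- 3 * \<i> * of_real s) 0)" "r \<noteq> 0" "r^2 \<noteq> s^2"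
  shows "g$1$3 = 0" "g$2$3 = 0"
proof -
  let ?h = "wform r 0 (- 3 * \<i> * of_real s) 0"
  have "rotation_matrix g" "144 * r^2 \<noteq> 0" "(144 * r^2)^2 \<noteq> (- 144 * r * s)^2"
    using assms by (simp_all add: stab_iff power_mult_distrib power2_eq_square)
  moreover have "trace (hess ?h u ** hess ?h v) = 72 * (r^2 + s^2) * (u \<bullet> v)
      + 144 * r^2 * (u$3 * v$3) + (- 144 * r * s) * (u$1 * v$2 + u$2 * v$1)" for u v
    unfolding trace_hess_Z2 by simp
  ultimately show "g$1$3 = 0" "g$2$3 = 0"
    using trace_hess_stab[OF cubic_form_wform assms(1)] by (rule invariant_form_z_line)+
qed

text \<open>Here \<open>t = 0\<close>, so the only obstruction is \<open>q = 0\<close>. Taking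
  \<open>r = 0\<close> serves the \<open>S3\<close> form as well.\<close>

lemma z_line_Z3:
  assumes "g \<in> stab (wform r 0 0 (of_real s))" "s^2 \<noteq> 2 * r^2"
  shows "g$1$3 = 0" "g$2$3 = 0"
proof -
  let ?h = "wform r 0 0 (of_real s)"
  show "g$1$3 = 0" "g$2$3 = 0"
    using invariant_form_z_line[where g = g and q = "72 * (2 * r^2 - s^2)" and t = 0
        and p = "72 * (r^2 + s^2)" and B = "\<lambda>u v. trace (hess ?h u ** hess ?h v)"]
      trace_hess_stab[OF cubic_form_wform assms(1)] assms
    by (simp_all add: trace_hess_Z3 stab_iff)
qed

lemma rotz_in_stab_wform:
  assumes "cmod w = 1"
  shows "rotz w \<in> stab (wform a b c d) \<longleftrightarrow> b * w = b \<and> c * w^2 = c \<and> d * w^3 = d"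
proof -
  have "rotz w \<in> stab (wform a b c d) \<longleftrightarrow> wform a (b * w) (c * w^2) (d * w^3) = wform a b c d"
    using assms by (simp add: stab_iff wform_rotz rotation_matrix_rotz fun_eq_iff)
  then show ?thesis by (simp add: wform_eq_iff)
qed

lemma rotz_flip_in_stab_wform:
  assumes "cmod w = 1"
  shows "rotz w ** flip \<in> stab (wform a b c d) \<longleftrightarrow>
    a = 0 \<and> cnj (b * w) = b \<and> - cnj (c * w^2) = c \<and> cnj (d * w^3) = d"
proof -
  have "rotz w ** flip \<in> stab (wform a b c d) \<longleftrightarrow>
      wform (- a) (cnj (b * w)) (- cnj (c * w^2)) (cnj (d * w^3)) = wform a b c d"
    using assms by (simp add: stab_iff wform_rotz wform_flip rotation_matrix_rotz rotation_matrix_mult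
        rotation_matrix_flip fun_eq_iff flip: matrix_vector_mul_assoc)
  then show ?thesis by (simp add: wform_eq_iff)
qed

text \<open>Elements reversing the \<open>z\<close>-axis would negate \<open>a\<close>, so
  \<open>a \<noteq> 0\<close> leaves only rotations about that axis, which act on \<open>c\<close>
  and \<open>d\<close> by \<open>w^2\<close> and \<open>w^3\<close>.\<close>

lemma stab_wform_z_line:
  assumes "\<And>g. g \<in> stab (wform a 0 c d) \<Longrightarrow> g$1$3 = 0 \<and> g$2$3 = 0" "a \<noteq> 0"
  shows "stab (wform a 0 c d) = rotz ` {w. cmod w = 1 \<and> c * w^2 = c \<and> d * w^3 = d}"
proof (intro equalityI subsetI)
  fix g assume g: "g \<in> stab (wform a 0 c d)"
  then have "rotation_matrix g" "g$1$3 = 0" "g$2$3 = 0" using assms(1) by (auto simp: stab_iff)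
  then show "g \<in> rotz ` {w. cmod w = 1 \<and> c * w^2 = c \<and> d * w^3 = d}"
    by (rule rotation_z_line) (use g assms(2) in \<open>auto simp: rotz_in_stab_wform rotz_flip_in_stab_wform\<close>)
qed (auto simp: rotz_in_stab_wform)

lemma norm_root_of_unity: "w ^ n = 1 \<Longrightarrow> n > 0 \<Longrightarrow> cmod w = 1"
  by (metis norm_ge_zero norm_one norm_power power_eq_imp_eq_base power_one zero_le_one)

lemma stab_SO2:
  assumes "r > 0"
  shows "stab (cubic (Form_SO2 r)) = rotz ` {w. cmod w = 1}"
proof -
  have "stab (wform r 0 0 0) = rotz ` {w. cmod w = 1 \<and> 0 * w^2 = 0 \<and> 0 * w^3 = 0}"
    using assms z_line_Z2[of _ r 0] by (intro stab_wform_z_line) auto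
  then show ?thesis unfolding cubic_eq_wform by simp
qed

lemma stab_Z2:
  assumes "admissible (Form_Z2 r s)"
  shows "stab (cubic (Form_Z2 r s)) = rotz ` {w. w^2 = 1}"
proof -
  have "stab (cubic (Form_Z2 r s)) = rotz ` {w. cmod w = 1 \<and> (- 3 * \<i> * of_real s) * w^2 = - 3 * \<i> * of_real s \<and> 0 * w^3 = 0}"
    unfolding cubic_eq_wform using assms z_line_Z2[of _ r s]
    by (intro stab_wform_z_line) (auto simp: power2_eq_iff)
  moreover have "{w. cmod w = 1 \<and> (- 3 * \<i> * of_real s) * w^2 = - 3 * \<i> * of_real s \<and> 0 * w^3 = 0} = {w. w^2 = 1}"
    using assms by (auto intro: norm_root_of_unity[of _ 2])
  ultimately show ?thesis by presburger
qed

lemma stab_Z3: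
  assumes "admissible (Form_Z3 r s)"
  shows "stab (cubic (Form_Z3 r s)) = rotz ` {w. w^3 = 1}"
proof -
  have "s^2 \<noteq> (r * sqrt 2)^2"
    using assms by (simp add: power2_eq_iff_nonneg)
  then have "stab (cubic (Form_Z3 r s)) = rotz ` {w. cmod w = 1 \<and> 0 * w^2 = 0 \<and> of_real s * w^3 = of_real s}"
    unfolding cubic_eq_wform using assms z_line_Z3[of _ r s]
    by (intro stab_wform_z_line) (auto simp: power_mult_distrib)
  moreover have "{w. cmod w = 1 \<and> 0 * w^2 = 0 \<and> of_real s * w^3 = of_real s} = {w. w^3 = 1}"
    using assms by (auto intro: norm_root_of_unity[of _ 3])
  ultimately show ?thesis by presburger
qed

text \<open>With \<open>a = 0\<close> the elements reversing the \<open>z\<close>-axis survive. For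
  them the condition is \<open>cnj (s * w^3) = s\<close>, which again means \<open>w^3 = 1\<close>
  because \<open>s\<close> is real and nonzero.\<close>

lemma stab_S3:
  assumes "s > 0"
  shows "stab (cubic (Form_S3 s)) = rotz ` {w. w^3 = 1} \<union> (\<lambda>w. rotz w ** flip) ` {w. w^3 = 1}"
    (is "_ = ?S")
proof (intro equalityI subsetI)
  have cnj1: "cnj w = 1 \<longleftrightarrow> w = 1" for w by (metis complex_cnj_cnj complex_cnj_one)
  fix g assume "g \<in> stab (cubic (Form_S3 s))"
  then have g: "g \<in> stab (wform 0 0 0 s)" unfolding cubic_eq_wform .
  then have "rotation_matrix g" "g$1$3 = 0" "g$2$3 = 0"
    using assms z_line_Z3[of g 0 s] by (auto simp: stab_iff)
  then show "g \<in> ?S"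
    by (rule rotation_z_line) (use g assms cnj1 in \<open>auto simp: rotz_in_stab_wform rotz_flip_in_stab_wform
      simp del: complex_cnj_power simp flip: complex_cnj_power\<close>)
next
  fix g assume "g \<in> ?S"
  then show "g \<in> stab (cubic (Form_S3 s))"
    unfolding cubic_eq_wform using norm_root_of_unity[of _ 3]
    by (auto simp: rotz_in_stab_wform rotz_flip_in_stab_wform)
qed

section \<open>Cyclic groups of rotations\<close>

lemma subgroup_SO_mult: "subgroup H SO3 \<Longrightarrow> A \<in> H \<Longrightarrow> B \<in> H \<Longrightarrow> A ** B \<in> H"
  using subgroup.m_closed by fastforce

lemma root_of_unity_power:
  assumes "w ^ n = 1" "n > 0"
  obtains k where "k < n" "w = cis (2 * pi / n) ^ k"
proof -
  obtain k where "k < n" "w = cis (2 * pi * real k / real n)"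
    using bij_betw_imp_surj_on[OF Complex.bij_betw_roots_unity[OF assms(2)]] assms(1) by auto
  then show ?thesis by (intro that[of k]) (auto simp: Complex.DeMoivre algebra_simps)
qed

lemma subgroup_rotz_roots: "n > 0 \<Longrightarrow> subgroup (rotz ` {w. w ^ n = 1}) SO3"
proof (rule group.subgroupI[OF group_SO])
  assume n: "n > 0"
  fix A assume "A \<in> rotz ` {w. w ^ n = 1}"
  then obtain w where w: "w ^ n = 1" "A = rotz w" by auto
  then have "inv\<^bsub>SO3\<^esub> A = rotz (inverse w)"
    using n norm_root_of_unity[of w n] rotation_matrix_rotz[of w] rotation_matrix_rotz[of "inverse w"]
    by (intro group.inv_equality[OF group_SO])
      (auto simp: rotz_mult norm_inverse simp flip: rotz_one intro!: left_inverse)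
  then show "inv\<^bsub>SO3\<^esub> A \<in> rotz ` {w. w ^ n = 1}"
    using w by (auto simp: power_inverse)
qed (auto simp: rotz_mult power_mult_distrib intro!: rotation_matrix_rotz exI[of _ 1] intro: norm_root_of_unity)

lemma rotz_power_in_generate:
  assumes "rotz w \<in> S"
  shows "rotz (w ^ k) \<in> generate SO3 S"
proof (induction k)
  case 0
  show ?case using generate.one[of SO3 S] by (simp add: rotz_one)
next
  case (Suc k)
  then show ?case
    using generate.eng[OF generate.incl[OF assms], of "rotz (w ^ k)" SO3] by (simp add: rotz_mult)
qed

lemma cis_power_eq_1: "n > 0 \<Longrightarrow> cis (2 * pi / real n) ^ n = 1"
  by (simp add: Complex.DeMoivre)

lemma generate_rotz_roots:
  assumes "n > 0"
  shows "generate SO3 {rotz (cis (2 * pi / n))} = rotz ` {w. w ^ n = 1}"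
proof
  show "generate SO3 {rotz (cis (2 * pi / n))} \<subseteq> rotz ` {w. w ^ n = 1}"
    using cis_power_eq_1[OF assms] subgroup_rotz_roots[OF assms]
    by (intro group.generate_subgroup_incl[OF group_SO]) blast+
  show "rotz ` {w. w ^ n = 1} \<subseteq> generate SO3 {rotz (cis (2 * pi / n))}"
  proof clarify
    fix w :: complex assume "w ^ n = 1"
    then obtain k where "w = cis (2 * pi / n) ^ k"
      using root_of_unity_power[OF _ assms] by metis
    then show "rotz w \<in> generate SO3 {rotz (cis (2 * pi / n))}"
      using rotz_power_in_generate[of "cis (2 * pi / n)"] by blast
  qed
qed

lemma power_mod_root_of_unity: "w ^ n = 1 \<Longrightarrow> w ^ (k mod n) = w ^ k" for w :: "'a::monoid_mult"
  by (metis mult_div_mod_eq mult_1 power_add power_mult power_one)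

lemma iso_integer_mod_group:
  assumes "n > 0"
  shows "SO3\<lparr>carrier := rotz ` {w. w ^ n = 1}\<rparr> \<cong> integer_mod_group n"
proof -
  let ?G = "SO3\<lparr>carrier := rotz ` {w. w ^ n = 1}\<rparr>"
  define \<omega> where "\<omega> = cis (2 * pi / n)"
  have \<omega>: "\<omega> ^ n = 1" using cis_power_eq_1[OF assms] by (simp add: \<omega>_def)
  \<comment> \<open>The carrier of \<open>integer_mod_group n\<close> consists of the integers
    \<open>0..<n\<close>, hence the conversion by \<open>nat\<close>.\<close>
  let ?f = "\<lambda>k. rotz (\<omega> ^ nat k)"
  have carrier: "carrier (integer_mod_group n) = {0..<int n}"
    using assms by (simp add: carrier_integer_mod_group)
  have "?f \<in> hom (integer_mod_group n) ?G"
  proof (rule homI)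
    fix x assume "x \<in> carrier (integer_mod_group n)"
    have "(\<omega> ^ nat x) ^ n = 1" by (metis \<omega> mult.commute power_mult power_one)
    then show "?f x \<in> carrier ?G" by simp
  next
    fix x y assume "x \<in> carrier (integer_mod_group n)" "y \<in> carrier (integer_mod_group n)"
    then have "nat ((x + y) mod int n) = (nat x + nat y) mod n"
      by (simp add: carrier nat_mod_distrib nat_add_distrib)
    then show "?f (x \<otimes>\<^bsub>integer_mod_group n\<^esub> y) = ?f x \<otimes>\<^bsub>?G\<^esub> ?f y"
      by (simp add: power_mod_root_of_unity[OF \<omega>] rotz_mult power_add)
  qed
  moreover have "bij_betw ?f (carrier (integer_mod_group n)) (carrier ?G)"
  proof -
    have 1: "bij_betw nat {0..<int n} {..<n}"
      by (rule bij_betwI[of _ _ _ int]) auto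
    have "cis (2 * pi * real k / real n) = \<omega> ^ k" for k
      by (simp add: \<omega>_def Complex.DeMoivre algebra_simps)
    then have 2: "bij_betw (\<lambda>k. \<omega> ^ k) {..<n} {w. w ^ n = 1}"
      using Complex.bij_betw_roots_unity[OF assms] by simp
    have 3: "bij_betw rotz {w. w ^ n = 1} (rotz ` {w. w ^ n = 1})"
      by (auto simp: bij_betw_def inj_on_def)
    show ?thesis
      using bij_betw_trans[OF bij_betw_trans[OF 1 2] 3] by (simp add: carrier o_def)
  qed
  ultimately have "integer_mod_group n \<cong> ?G" by (auto simp: is_iso_def iso_def)
  then show ?thesis by (rule group.iso_sym[OF group_integer_mod_group])
qed

lemma card_rotz_roots: "n > 0 \<Longrightarrow> card (rotz ` {w. w ^ n = 1}) = n"
  by (subst card_image) (auto simp: inj_on_def card_roots_unity_eq)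

section \<open>The circle group and its identification with SO(2)\<close>

lemma range_rotation_about_z: "range (rotation_about z_axis) = rotz ` {w. cmod w = 1}"
proof -
  have "range cis = {w. cmod w = 1}"
  proof (intro equalityI subsetI)
    fix w assume "w \<in> {w. cmod w = 1}"
    then have "w \<noteq> 0" "sgn w = w" by (auto simp: sgn_div_norm)
    then have "w = cis (Arg w)" by (simp add: cis_Arg)
    then show "w \<in> range cis" by blast
  qed auto
  then show ?thesis by (metis (no_types) rotation_about_z image_image image_cong)
qed

definition rot2 :: "complex \<Rightarrow> real^2^2" where
  "rot2 w = vector [vector [Re w, - Im w], vector [Im w, Re w]]"

lemma rot2_mult: "rot2 w ** rot2 w' = rot2 (w * w')"
  by (simp add: rot2_def vec_eq_iff forall_2 matrix_matrix_mult_def sum_2 algebra_simps)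

lemma carrier_SO2: "carrier SO2 = rot2 ` {w. cmod w = 1}"
proof (intro equalityI subsetI)
  fix A :: "real^2^2" assume "A \<in> carrier SO2"
  then have o: "(transpose A ** A)$i$j = mat 1$i$j" and d: "det A = 1" for i j
    by (simp_all add: rotation_matrix_inverse) (simp add: rotation_matrix_def)
  have 1: "A$1$1 * A$1$1 + A$2$1 * A$2$1 = 1" and 2: "A$1$2 * A$1$2 + A$2$2 * A$2$2 = 1"
    using o[of 1 1] o[of 2 2] by (simp_all add: transpose_def matrix_matrix_mult_def sum_2 mat_def)
  have "(A$1$1 - A$2$2) * (A$1$1 - A$2$2) + (A$1$2 + A$2$1) * (A$1$2 + A$2$1) = 0"
    using 1 2 d by (simp add: det_2 algebra_simps)
  then have "A$1$1 - A$2$2 = 0 \<and> A$1$2 + A$2$1 = 0"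
    by (simp only: sum_squares_eq_zero_iff)
  then have "A = rot2 (Complex (A$1$1) (A$2$1))"
    by (auto simp: rot2_def vec_eq_iff forall_2)
  moreover have "cmod (Complex (A$1$1) (A$2$1)) = 1"
    using 1 by (simp add: cmod_def power2_eq_square)
  ultimately show "A \<in> rot2 ` {w. cmod w = 1}" by blast
next
  fix A assume "A \<in> rot2 ` {w. cmod w = 1}"
  then obtain w where "A = rot2 w" "Re w * Re w + Im w * Im w = 1"
    using cmod_power2 by (auto simp: power2_eq_square) (metis one_power2 power2_eq_square)
  then show "A \<in> carrier SO2"
    by (simp add: rotation_matrix_def orthogonal_matrix_def det_2 rot2_def vec_eq_iff forall_2
        matrix_matrix_mult_def sum_2 transpose_def mat_def algebra_simps)
qed

lemma iso_SO2: "SO3\<lparr>carrier := rotz ` {w. cmod w = 1}\<rparr> \<cong> SO2"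
proof -
  let ?G = "SO3\<lparr>carrier := rotz ` {w. cmod w = 1}\<rparr>"
  \<comment> \<open>The first column of \<open>rotz w\<close> recovers \<open>w\<close>, so the
    isomorphism is given by a formula in the matrix entries.\<close>
  let ?f = "\<lambda>g. rot2 (Complex (g$1$1) (g$2$1))"
  have f: "rotz w $ 1 $ 1 = Re w" "rotz w $ 2 $ 1 = Im w" for w by (simp_all add: rotz_def)
  have inj: "rot2 w = rot2 w' \<longleftrightarrow> w = w'" for w w'
    by (auto simp: rot2_def vec_eq_iff forall_2 complex_eq_iff)
  have "?f \<in> hom ?G SO2"
    by (rule homI) (auto simp: f rotz_mult rot2_mult carrier_SO2 inj complex_eq_iff simp del: SO_simps(1))
  moreover have "bij_betw ?f (carrier ?G) (carrier SO2)"
    by (auto simp: bij_betw_def inj_on_def f inj carrier_SO2 image_image complex_eq_iff simp del: SO_simps(1))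
  ultimately show ?thesis by (auto simp: is_iso_def iso_def)
qed

section \<open>Permutations of equiangular frames\<close>

text \<open>Replaces a surjectivity proof: an embedding of the permutation group together with an
  upper bound on the order of the stabilizer yields both the isomorphism and the exact
  order.\<close>

lemma iso_by_card:
  assumes "\<phi> \<in> hom G H" "inj_on \<phi> (carrier G)" "finite (carrier H)" "card (carrier H) \<le> card (carrier G)"
  shows "\<phi> \<in> iso G H" "card (carrier H) = card (carrier G)"
proof -
  have sub: "\<phi> ` carrier G \<subseteq> carrier H" using assms(1) by (auto simp: hom_def)
  have "card (\<phi> ` carrier G) = card (carrier G)" using assms(2) by (rule card_image)
  then have "\<phi> ` carrier G = carrier H" and "card (carrier H) = card (carrier G)"
    using card_seteq[OF assms(3) sub] assms(4) by auto
  then show "\<phi> \<in> iso G H" "card (carrier H) = card (carrier G)"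
    using assms by (auto simp: iso_def bij_betw_def)
qed

text \<open>Vectors with constant lengths and constant mutual angles that form a tight frame. No
  symmetry distinguishes the indices, so every permutation of them is induced by an orthogonal
  map.\<close>

locale equiangular_frame =
  fixes w :: "'i \<Rightarrow> real^'n" and I :: "'i set" and c \<alpha> \<beta> :: real
  assumes finite: "finite I" and c: "c \<noteq> 0" and inj: "inj_on w I"
    and tight: "\<And>v. (\<Sum>i\<in>I. (w i \<bullet> v) *\<^sub>R w i) = c *\<^sub>R v"
    and angle: "\<And>i j. i \<in> I \<Longrightarrow> j \<in> I \<Longrightarrow> w i \<bullet> w j = (if i = j then \<alpha> else \<beta>)"
begin

text \<open>The frame expansion of \<open>v\<close> with the synthesis vectors permuted. The vectors
  may be linearly dependent, as four vectors in space are, so prescribing images on the frame would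
  not by itself define a linear map.\<close>

definition perm_map :: "('i \<Rightarrow> 'i) \<Rightarrow> real^'n^'n" where
  "perm_map \<sigma> = matrix (\<lambda>v. (1 / c) *\<^sub>R (\<Sum>i\<in>I. (w i \<bullet> v) *\<^sub>R w (\<sigma> i)))"

lemma perm_map: "perm_map \<sigma> *v v = (1 / c) *\<^sub>R (\<Sum>i\<in>I. (w i \<bullet> v) *\<^sub>R w (\<sigma> i))"
proof -
  have "linear (\<lambda>v. (1 / c) *\<^sub>R (\<Sum>i\<in>I. (w i \<bullet> v) *\<^sub>R w (\<sigma> i)))"
    by (rule linearI)
      (simp_all add: inner_right_distrib scaleR_add_left sum.distrib scaleR_add_right scaleR_right.sum mult.commute)
  then show ?thesis by (simp add: perm_map_def matrix_works)
qed

lemma angle_perm: "\<sigma> permutes I \<Longrightarrow> i \<in> I \<Longrightarrow> j \<in> I \<Longrightarrow> w (\<sigma> i) \<bullet> w (\<sigma> j) = w i \<bullet> w j"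
  using permutes_in_image[of \<sigma> I] permutes_inj[of \<sigma> I] by (auto simp: angle inj_eq)

text \<open>The coefficient \<open>w i \<bullet> w j\<close> is unchanged when both indices are
  permuted; reindexing then turns the sum into the frame expansion of
  \<open>w (\<sigma> j)\<close>.\<close>

lemma perm_map_w:
  assumes "\<sigma> permutes I" "j \<in> I"
  shows "perm_map \<sigma> *v w j = w (\<sigma> j)"
proof -
  have "(\<Sum>i\<in>I. (w i \<bullet> w j) *\<^sub>R w (\<sigma> i)) = (\<Sum>i\<in>I. (w (\<sigma> i) \<bullet> w (\<sigma> j)) *\<^sub>R w (\<sigma> i))"
    using assms by (intro sum.cong) (auto simp: angle_perm)
  also have "\<dots> = (\<Sum>i\<in>I. (w i \<bullet> w (\<sigma> j)) *\<^sub>R w i)"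
    using sum.permute[OF assms(1), of "\<lambda>i. (w i \<bullet> w (\<sigma> j)) *\<^sub>R w i"] by (simp add: o_def)
  finally show ?thesis using c by (simp add: perm_map tight)
qed

lemma inner_tight: "(\<Sum>i\<in>I. (w i \<bullet> u) * (w i \<bullet> v)) = c * (u \<bullet> v)"
  using arg_cong[OF tight[of u], of "\<lambda>x. x \<bullet> v"] by (simp add: inner_sum_left)

lemma inner_perm_map:
  assumes "\<sigma> permutes I" "j \<in> I"
  shows "w (\<sigma> j) \<bullet> (perm_map \<sigma> *v v) = w j \<bullet> v"
proof -
  have "w (\<sigma> j) \<bullet> (perm_map \<sigma> *v v) = (1 / c) * (\<Sum>i\<in>I. (w i \<bullet> v) * (w (\<sigma> j) \<bullet> w (\<sigma> i)))"
    by (simp add: perm_map inner_sum_right)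
  also have "\<dots> = (1 / c) * (\<Sum>i\<in>I. (w i \<bullet> v) * (w i \<bullet> w j))"
    using assms by (intro arg_cong[where f = "\<lambda>x. _ * x"] sum.cong) (auto simp: angle_perm inner_commute)
  also have "\<dots> = w j \<bullet> v"
    using c by (subst inner_tight) (simp add: inner_commute)
  finally show ?thesis .
qed

text \<open>An orthogonal map that permutes the frame permutes the frame coordinates of
  \<open>v\<close>, so their power sums are invariant. This is how cubics built from such sums
  acquire permutation symmetry.\<close>

lemma sum_perm_map:
  assumes "\<sigma> permutes I"
  shows "(\<Sum>i\<in>I. f (w i \<bullet> (perm_map \<sigma> *v v))) = (\<Sum>i\<in>I. f (w i \<bullet> v))"
  using assms sum.permute[OF assms, of "\<lambda>i. f (w i \<bullet> (perm_map \<sigma> *v v))"]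
  by (simp add: o_def inner_perm_map)

lemma orthogonal_perm_map:
  assumes "\<sigma> permutes I"
  shows "orthogonal_matrix (perm_map \<sigma>)"
proof -
  have "c * ((perm_map \<sigma> *v u) \<bullet> (perm_map \<sigma> *v v)) = c * (u \<bullet> v)" for u v
    using sum.permute[OF assms, of "\<lambda>i. (w i \<bullet> (perm_map \<sigma> *v u)) * (w i \<bullet> (perm_map \<sigma> *v v))"] assms
    by (simp add: o_def inner_perm_map flip: inner_tight)
  then have "orthogonal_transformation ((*v) (perm_map \<sigma>))"
    using c by (simp add: orthogonal_transformation_def)
  then show ?thesis by (simp add: orthogonal_transformation_matrix)
qed

lemma perm_map_mult:
  assumes "\<sigma> permutes I" "\<tau> permutes I"
  shows "perm_map \<sigma> ** perm_map \<tau> = perm_map (\<sigma> \<circ> \<tau>)"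
proof -
  have "perm_map \<sigma> *v (perm_map \<tau> *v v) = perm_map (\<sigma> \<circ> \<tau>) *v v" for v
  proof -
    have "perm_map \<sigma> *v (perm_map \<tau> *v v) = (1 / c) *\<^sub>R (\<Sum>i\<in>I. (w i \<bullet> v) *\<^sub>R (perm_map \<sigma> *v w (\<tau> i)))"
      by (subst perm_map[of \<tau>]) (simp add: matrix_vector_mult_scaleR linear_sum[OF matrix_vector_mul_linear])
    also have "\<dots> = perm_map (\<sigma> \<circ> \<tau>) *v v"
      unfolding perm_map[of "\<sigma> \<circ> \<tau>"] using assms
      by (intro arg_cong[where f = "\<lambda>x. _ *\<^sub>R x"] sum.cong) (auto simp: perm_map_w permutes_in_image)
    finally show ?thesis .
  qed
  then show ?thesis by (simp add: matrix_eq flip: matrix_vector_mul_assoc)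
qed

lemma perm_map_id: "perm_map id = mat 1"
  using c by (simp add: matrix_eq perm_map tight)

lemma inj_perm_map: "inj_on perm_map {\<sigma>. \<sigma> permutes I}"
proof (rule inj_onI)
  fix \<sigma> \<tau> assume *: "\<sigma> \<in> {\<sigma>. \<sigma> permutes I}" "\<tau> \<in> {\<sigma>. \<sigma> permutes I}" "perm_map \<sigma> = perm_map \<tau>"
  show "\<sigma> = \<tau>"
  proof
    fix j
    show "\<sigma> j = \<tau> j"
    proof (cases "j \<in> I")
      case True
      then have "w (\<sigma> j) = w (\<tau> j)" using * perm_map_w by (metis mem_Collect_eq)
      then show ?thesis using True * inj by (auto simp: inj_on_def permutes_in_image)
    qed (use * in \<open>simp add: permutes_def\<close>)
  qed
qed

end

text \<open>Alternate vertices of a cube. Indices are taken from \<open>{1..4}\<close> to match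
  \<open>alt_group 4\<close>.\<close>

definition tetrahedron :: "nat \<Rightarrow> real^3" where
  "tetrahedron i = (if i = 1 then vector [1, 1, 1] else if i = 2 then vector [1, -1, -1]
     else if i = 3 then vector [-1, 1, -1] else vector [-1, -1, 1])"

text \<open>An orthogonal basis of vectors of length \<open>sqrt 3\<close>, turned so that its sum
  lies on the \<open>z\<close>-axis; the horizontal parts are \<open>sqrt 2\<close> times the cube
  roots of unity.\<close>

definition tripod :: "nat \<Rightarrow> real^3" where
  "tripod i = (if i = 1 then vector [sqrt 2, 0, 1] else if i = 2 then vector [- sqrt 2 / 2, sqrt 6 / 2, 1]
     else vector [- sqrt 2 / 2, - sqrt 6 / 2, 1])"

lemma atLeastAtMost_1_4: "{1..4} = {1, 2, 3, 4 :: nat}" by auto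
lemma atLeastAtMost_1_3: "{1..3} = {1, 2, 3 :: nat}" by auto

lemma sqrt_simps:
  "sqrt 6 = sqrt 2 * sqrt 3" "sqrt 2 * (sqrt 2 * y) = 2 * y" "sqrt 3 * (sqrt 3 * y) = 3 * y"
  by (simp_all flip: real_sqrt_mult mult.assoc)

interpretation tetra: equiangular_frame tetrahedron "{1..4}" 4 3 "-1"
proof (unfold_locales, unfold atLeastAtMost_1_4)
  show "inj_on tetrahedron {1, 2, 3, 4}"
    by (simp add: tetrahedron_def vec_eq_iff forall_3)
qed (auto simp: tetrahedron_def inner_vec_def sum_3 vec_eq_iff forall_3)

interpretation tri: equiangular_frame tripod "{1..3}" 3 3 0
proof (unfold_locales, unfold atLeastAtMost_1_3)
  show "inj_on tripod {1, 2, 3}"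
    by (simp add: tripod_def vec_eq_iff forall_3)
qed (auto simp: tripod_def inner_vec_def sum_3 vec_eq_iff forall_3 field_simps sqrt_simps)

section \<open>The tetrahedral form\<close>

declare One_nat_def [simp del]

text \<open>In the four cubes all terms except the mixed one cancel by sign, and each cube
  contributes \<open>6 x y z\<close>.\<close>

lemma cubic_A4_tetrahedron: "24 * cubic_A4 v = (\<Sum>i\<in>{1..4}. (tetrahedron i \<bullet> v) ^ 3)"
  unfolding atLeastAtMost_1_4
  by (simp add: tetrahedron_def inner_vec_def sum_3 cubic_A4_def Let_def power3_eq_cube algebra_simps)

lemma cubic_A4_perm_map: "\<sigma> permutes {1..4} \<Longrightarrow> cubic_A4 (tetra.perm_map \<sigma> *v v) = cubic_A4 v"
  using cubic_A4_tetrahedron[of "tetra.perm_map \<sigma> *v v"] cubic_A4_tetrahedron[of v]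
    tetra.sum_perm_map[of \<sigma> "\<lambda>x. x ^ 3" v] by simp

text \<open>The matrix of a three-cycle has cube 1, so its determinant is a real cube root of 1.
  Since three-cycles generate the alternating group, no comparison of determinant and sign is
  needed.\<close>

lemma det_three_cycle:
  assumes "\<sigma> \<in> three_cycles 4"
  shows "det (tetra.perm_map \<sigma>) = 1"
proof -
  obtain cs where cs: "\<sigma> = cycle_of_list cs" "cycle cs" "length cs = 3" "set cs \<subseteq> {1..4}"
    using assms by auto
  have p: "\<sigma> permutes {1..4}" using permutes_subset[OF cycle_permutes cs(4)] cs(1) by simp
  have "\<sigma> \<circ> \<sigma> \<circ> \<sigma> = id" using cycle_is_id_root[OF cs(2)] cs by (simp add: numeral_3_eq_3 o_assoc)
  then have "tetra.perm_map \<sigma> ** tetra.perm_map \<sigma> ** tetra.perm_map \<sigma> = mat 1"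
    using p by (simp add: tetra.perm_map_mult permutes_compose tetra.perm_map_id)
  then have "det (tetra.perm_map \<sigma> ** tetra.perm_map \<sigma> ** tetra.perm_map \<sigma>) = 1" by simp
  then have "det (tetra.perm_map \<sigma>) ^ 3 = 1" by (simp add: det_mul power3_eq_cube)
  moreover have "det (tetra.perm_map \<sigma>) = 1 \<or> det (tetra.perm_map \<sigma>) = - 1"
    by (rule det_orthogonal_matrix[OF tetra.orthogonal_perm_map[OF p]])
  ultimately show ?thesis by auto
qed

lemma det_alt_group:
  assumes "\<sigma> \<in> carrier (alt_group 4)"
  shows "det (tetra.perm_map \<sigma>) = 1"
proof -
  interpret alt: group "alt_group 4" by (rule alt_group_is_group)
  have perm: "\<sigma> permutes {1..4}" if "\<sigma> \<in> carrier (alt_group 4)" for \<sigma>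
    using that by (simp add: alt_group_carrier)
  have mult: "det (tetra.perm_map (\<sigma> \<otimes>\<^bsub>alt_group 4\<^esub> \<tau>)) = det (tetra.perm_map \<sigma>) * det (tetra.perm_map \<tau>)"
    if "\<sigma> \<in> carrier (alt_group 4)" "\<tau> \<in> carrier (alt_group 4)" for \<sigma> \<tau>
    using that[THEN perm] by (simp add: alt_group_mult det_mul flip: tetra.perm_map_mult)
  have det_one: "det (tetra.perm_map \<one>\<^bsub>alt_group 4\<^esub>) = 1"
    unfolding alt_group_one by (simp add: tetra.perm_map_id)
  note gen = alt.generate_in_carrier[OF three_cycles_incl]
  have "\<sigma> \<in> generate (alt_group 4) (three_cycles 4)"
    using assms alt_group_carrier_as_three_cycles by blast
  then show ?thesis
  proof (induction rule: generate.induct)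
    case one
    show ?case by (rule det_one)
  next
    case (incl h)
    then show ?case by (rule det_three_cycle)
  next
    case (inv h)
    then have h: "h \<in> carrier (alt_group 4)" using three_cycles_incl by blast
    then have "det (tetra.perm_map (inv\<^bsub>alt_group 4\<^esub> h)) * det (tetra.perm_map h) = 1"
      using mult[OF alt.inv_closed[OF h] h] det_one by (simp only: alt.l_inv[OF h])
    then show ?case using det_three_cycle[OF inv] by (simp only: mult_1_right)
  next
    case (eng h1 h2)
    have "h1 \<in> carrier (alt_group 4)" "h2 \<in> carrier (alt_group 4)"
      using eng.hyps by (auto intro: gen)
    then show ?case using mult eng.IH by simp
  qed
qed

definition V4 :: "(real^3^3) set" where
  "V4 = {mat 1, diag3 1 (- 1) (- 1), diag3 (- 1) 1 (- 1), diag3 (- 1) (- 1) 1}"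

definition C3 :: "(real^3^3) set" where "C3 = {mat 1, cyc, cyc ** cyc}"

lemma unit_vector_of_plane:
  fixes a :: "real^3"
  assumes n: "a$1 * a$1 + a$2 * a$2 + a$3 * a$3 = 1"
    and plane: "\<And>v. a \<bullet> v = 0 \<Longrightarrow> cubic_A4 v = 0"
  obtains k e where "e \<in> {1, - 1}" "a = e *\<^sub>R axis k 1"
proof -
  have *: "x * y * z = 0" if "a$1 * x + a$2 * y + a$3 * z = 0" for x y z
    using plane[of "vector [x, y, z]"] that by (simp add: inner_vec_def sum_3 cubic_A4_def)
  have "a$1 = 0 \<and> a$2 = 0 \<or> a$1 = 0 \<and> a$3 = 0 \<or> a$2 = 0 \<and> a$3 = 0"
  proof (rule ccontr)
    assume "\<not> ?thesis"
    then consider "a$1 \<noteq> 0" "a$2 \<noteq> 0" "a$3 \<noteq> 0" | "a$1 \<noteq> 0" "a$2 \<noteq> 0" "a$3 = 0"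
      | "a$1 \<noteq> 0" "a$2 = 0" "a$3 \<noteq> 0" | "a$1 = 0" "a$2 \<noteq> 0" "a$3 \<noteq> 0" by blast
    \<comment> \<open>If two entries of \<open>a\<close> were nonzero, the plane would contain a
      point with no zero coordinate; one such point is given for each pattern of nonzero
      entries.\<close>
    then show False
      using *[of "1 / a$1" "1 / a$2" "- 2 / a$3"] *[of "a$2" "- a$1" 1] *[of "a$3" 1 "- a$1"]
        *[of 1 "a$3" "- a$2"] by cases (auto simp: algebra_simps)
  qed
  then show ?thesis
  proof (elim disjE conjE)
    assume z: "a$1 = 0" "a$2 = 0"
    then have "a = a$3 *\<^sub>R axis 3 1" "a$3 \<in> {1, - 1}"
      using n by (auto simp: vec_eq_iff forall_3 axis_def square_eq_1_iff)
    then show ?thesis using that by blast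
  next
    assume z: "a$1 = 0" "a$3 = 0"
    then have "a = a$2 *\<^sub>R axis 2 1" "a$2 \<in> {1, - 1}"
      using n by (auto simp: vec_eq_iff forall_3 axis_def square_eq_1_iff)
    then show ?thesis using that by blast
  next
    assume z: "a$2 = 0" "a$3 = 0"
    then have "a = a$1 *\<^sub>R axis 1 1" "a$1 \<in> {1, - 1}"
      using n by (auto simp: vec_eq_iff forall_3 axis_def square_eq_1_iff)
    then show ?thesis using that by blast
  qed
qed

lemma cubic_A4_apply: "cubic_A4 (g *v v) = (g$1 \<bullet> v) * (g$2 \<bullet> v) * (g$3 \<bullet> v)"
  by (simp add: cubic_A4_def matrix_vector_mul_component)

lemma stab_A4_eq: "s > 0 \<Longrightarrow> stab (cubic (Form_A4 s)) = stab cubic_A4"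
  by (auto simp: stab_iff)

text \<open>Where a row of \<open>g\<close> vanishes, so does \<open>cubic_A4\<close> composed with
  \<open>g\<close>, hence \<open>cubic_A4\<close> itself. The kernel of each row is therefore a
  coordinate plane, which makes \<open>g\<close> a signed permutation matrix.\<close>

lemma stab_A4_subset: "stab cubic_A4 \<subseteq> (\<lambda>(D, P). D ** P) ` (V4 \<times> C3)"
proof
  fix g assume "g \<in> stab cubic_A4"
  then have g: "rotation_matrix g" "\<And>v. cubic_A4 (g *v v) = cubic_A4 v" by (auto simp: stab_iff)
  have row: "\<exists>k e. e \<in> {1, - 1} \<and> g$i = e *\<^sub>R axis k 1" for i
  proof -
    have "cubic_A4 v = 0" if "g$i \<bullet> v = 0" for v
      using that g(2)[of v] exhaust_3[of i] by (auto simp: cubic_A4_apply)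
    moreover have "g$i$1 * g$i$1 + g$i$2 * g$i$2 + g$i$3 * g$i$3 = 1"
      using rotation_matrix_entries(2)[OF g(1), of i i] by simp
    ultimately show ?thesis using unit_vector_of_plane by metis
  qed
  obtain k1 k2 k3 e1 e2 e3 where e: "e1 \<in> {1, - 1}" "e2 \<in> {1, - 1}" "e3 \<in> {1, - 1}"
    and r: "g$1 = e1 *\<^sub>R axis k1 1" "g$2 = e2 *\<^sub>R axis k2 1" "g$3 = e3 *\<^sub>R axis k3 1"
    using row[of 1] row[of 2] row[of 3] by blast
  have prod: "e1 * e2 * e3 = 1"
    using g(2)[of "vector [1, 1, 1]", unfolded cubic_A4_apply r] exhaust_3[of k1] exhaust_3[of k2] exhaust_3[of k3]
    by (auto simp: inner_axis' cubic_A4_def)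
  have D: "diag3 e1 e2 e3 \<in> V4"
    using e prod by (auto simp: V4_def diag3_one)
  have det: "det g = 1" using g(1) by (simp add: rotation_matrix_def)
  \<comment> \<open>The determinant is the product of the signs, which is 1, times the sign of the
    permutation; hence the permutation is cyclic.\<close>
  have "(k1, k2, k3) \<in> {(1, 2, 3), (3, 1, 2), (2, 3, 1)}"
    using exhaust_3[of k1] exhaust_3[of k2] exhaust_3[of k3] det[unfolded det_3 r] prod
    by (elim disjE; simp add: axis_def)
  moreover have "g = diag3 e1 e2 e3 ** mat 1" if "k1 = 1" "k2 = 2" "k3 = 3"
    using that by (simp add: vec_eq_iff forall_3 r axis_def diag3_def)
  moreover have "g = diag3 e1 e2 e3 ** cyc" if "k1 = 3" "k2 = 1" "k3 = 2"
    using that by (simp add: vec_eq_iff forall_3 r axis_def diag3_def cyc_def matrix_matrix_mult_def sum_3)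
  moreover have "g = diag3 e1 e2 e3 ** (cyc ** cyc)" if "k1 = 2" "k2 = 3" "k3 = 1"
    using that by (simp add: vec_eq_iff forall_3 r axis_def diag3_def cyc_def matrix_matrix_mult_def sum_3)
  ultimately have "\<exists>P\<in>C3. g = diag3 e1 e2 e3 ** P"
    unfolding C3_def by blast
  then show "g \<in> (\<lambda>(D, P). D ** P) ` (V4 \<times> C3)" using D by force
qed

lemma card_stab_A4: "finite (stab cubic_A4)" "card (stab cubic_A4) \<le> 12"
proof -
  have f: "finite V4" "finite C3" by (simp_all add: V4_def C3_def)
  have "card V4 \<le> 4" "card C3 \<le> 3"
    unfolding V4_def C3_def by (auto intro!: order_trans[OF card_insert_le_m1] simp: card_insert_if)
  then have "card V4 * card C3 \<le> 4 * 3" by (intro mult_le_mono)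
  moreover have "card ((\<lambda>(D, P). D ** P) ` (V4 \<times> C3)) \<le> card V4 * card C3"
    using f by (metis card_cartesian_product card_image_le finite_cartesian_product)
  moreover have fin: "finite ((\<lambda>(D, P). D ** P) ` (V4 \<times> C3))" using f by simp
  ultimately show "card (stab cubic_A4) \<le> 12"
    using card_mono[OF fin stab_A4_subset] by linarith
  show "finite (stab cubic_A4)" using finite_subset[OF stab_A4_subset fin] .
qed

lemma stab_A4_generate:
  defines "S \<equiv> {diag3 1 (- 1) (- 1), diag3 (- 1) 1 (- 1), diag3 (- 1) (- 1) 1, cyc}"
  shows "stab cubic_A4 = generate SO3 S"
proof
  have "S \<subseteq> stab cubic_A4"
    by (auto simp: S_def stab_iff cubic_A4_def rotation_matrix_cyc intro: rotation_matrix_diag3)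
  then show gen: "generate SO3 S \<subseteq> stab cubic_A4"
    by (rule group.generate_subgroup_incl[OF group_SO _ subgroup_stab])
  have "S \<subseteq> carrier SO3"
    by (auto simp: S_def rotation_matrix_cyc intro: rotation_matrix_diag3)
  then have sub: "subgroup (generate SO3 S) SO3"
    by (rule group.generate_is_subgroup[OF group_SO])
  have one: "mat 1 \<in> generate SO3 S" using generate.one[of SO3 S] by simp
  have "V4 \<subseteq> generate SO3 S" "cyc \<in> generate SO3 S"
    using one by (auto simp: V4_def S_def intro: generate.incl)
  moreover from this have "C3 \<subseteq> generate SO3 S"
    using one subgroup_SO_mult[OF sub] by (auto simp: C3_def)
  ultimately show "stab cubic_A4 \<subseteq> generate SO3 S"
    using stab_A4_subset subgroup_SO_mult[OF sub] by fastforce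
qed

lemma stab_A4_iso: "stab_group cubic_A4 \<cong> alt_group 4" "card (stab cubic_A4) = 12"
proof -
  have perm: "\<sigma> permutes {1..4}" if "\<sigma> \<in> carrier (alt_group 4)" for \<sigma>
    using that by (simp add: alt_group_carrier)
  have 1: "tetra.perm_map \<in> hom (alt_group 4) (stab_group cubic_A4)"
  proof (rule homI)
    fix \<sigma> assume s: "\<sigma> \<in> carrier (alt_group 4)"
    then show "tetra.perm_map \<sigma> \<in> carrier (stab_group cubic_A4)"
      using cubic_A4_perm_map[OF perm] det_alt_group tetra.orthogonal_perm_map[OF perm]
      by (simp add: stab_iff rotation_matrix_def)
  next
    fix \<sigma> \<tau> assume "\<sigma> \<in> carrier (alt_group 4)" "\<tau> \<in> carrier (alt_group 4)"
    then show "tetra.perm_map (\<sigma> \<otimes>\<^bsub>alt_group 4\<^esub> \<tau>) =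
        tetra.perm_map \<sigma> \<otimes>\<^bsub>stab_group cubic_A4\<^esub> tetra.perm_map \<tau>"
      using perm by (simp add: alt_group_mult tetra.perm_map_mult)
  qed
  have 2: "inj_on tetra.perm_map (carrier (alt_group 4))"
    using perm by (intro inj_on_subset[OF tetra.inj_perm_map]) blast
  have c: "card (carrier (alt_group 4)) = 12"
    using alt_group_card_carrier[of 4] by (simp add: fact_numeral)
  have 3: "tetra.perm_map \<in> iso (alt_group 4) (stab_group cubic_A4)"
    "card (stab cubic_A4) = card (carrier (alt_group 4))"
    using iso_by_card[OF 1 2] card_stab_A4 c by simp_all
  then show "card (stab cubic_A4) = 12" using c by simp
  have "alt_group 4 \<cong> stab_group cubic_A4" using 3(1) by (auto simp: is_iso_def)
  then show "stab_group cubic_A4 \<cong> alt_group 4" by (rule group.iso_sym[OF alt_group_is_group])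
qed

section \<open>The triangular form\<close>

lemma tripod_sum: "(\<Sum>i\<in>{1..3}. tripod i \<bullet> v) = 3 * v$3"
  unfolding atLeastAtMost_1_3 by (simp add: tripod_def inner_vec_def sum_3 algebra_simps)

text \<open>The remainder involves only the height and the length of \<open>v\<close>, both
  preserved by the permutation matrices, so \<open>cubic_S3\<close> inherits their symmetry.\<close>

lemma tripod_sum_cubes:
  "(\<Sum>i\<in>{1..3}. (tripod i \<bullet> v) ^ 3) =
     3 / 2 * sqrt 2 * cubic_S3 v + 9 * v$3 * (v \<bullet> v - v$3^2) + 3 * v$3^3"
  unfolding atLeastAtMost_1_3
  by (simp add: tripod_def inner_vec_def sum_3 cubic_S3_def Let_def power3_eq_cube power2_eq_square
      field_simps sqrt_simps)

lemma tri_perm_map_3: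
  assumes "\<sigma> permutes {1..3}"
  shows "(tri.perm_map \<sigma> *v v)$3 = v$3"
  using tripod_sum[of "tri.perm_map \<sigma> *v v"] tripod_sum[of v] tri.sum_perm_map[OF assms, of "\<lambda>x. x" v]
  by simp

lemma cubic_S3_perm_map:
  assumes "\<sigma> permutes {1..3}"
  shows "cubic_S3 (tri.perm_map \<sigma> *v v) = cubic_S3 v"
proof -
  let ?A = "tri.perm_map \<sigma>"
  have "orthogonal_transformation ((*v) ?A)"
    using tri.orthogonal_perm_map[OF assms] by (simp add: orthogonal_transformation_matrix)
  then have "(?A *v v) \<bullet> (?A *v v) = v \<bullet> v" by (simp add: orthogonal_transformation_def)
  then show ?thesis
    using tripod_sum_cubes[of "?A *v v"] tripod_sum_cubes[of v]
      tri.sum_perm_map[OF assms, of "\<lambda>x. x ^ 3" v] tri_perm_map_3[OF assms, of v] by simp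
qed

text \<open>Odd permutations give reflections fixing \<open>z\<close>. As \<open>cubic_S3\<close>
  does not involve \<open>z\<close>, multiplying \<open>z\<close> by the determinant turns them into
  rotations without losing invariance.\<close>

definition tri_rot :: "(nat \<Rightarrow> nat) \<Rightarrow> real^3^3" where
  "tri_rot \<sigma> = tri.perm_map \<sigma> ** diag3 1 1 (det (tri.perm_map \<sigma>))"

lemma tri_perm_map_entries:
  assumes "\<sigma> permutes {1..3}"
  shows "tri.perm_map \<sigma> $3$1 = 0" "tri.perm_map \<sigma> $3$2 = 0" "tri.perm_map \<sigma> $3$3 = 1"
    "tri.perm_map \<sigma> $1$3 = 0" "tri.perm_map \<sigma> $2$3 = 0"
proof -
  let ?A = "tri.perm_map \<sigma>"
  show r: "?A$3$1 = 0" "?A$3$2 = 0" "?A$3$3 = 1"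
    using tri_perm_map_3[OF assms, of "axis 1 1"] tri_perm_map_3[OF assms, of "axis 2 1"]
      tri_perm_map_3[OF assms, of "axis 3 1"]
    by (simp_all add: matrix_vector_mult_def sum_3 axis_def)
  have "(transpose ?A ** ?A)$3$3 = 1"
    using tri.orthogonal_perm_map[OF assms] by (simp add: orthogonal_matrix mat_def)
  then have "?A$1$3 * ?A$1$3 + ?A$2$3 * ?A$2$3 = 0"
    using r(3) by (simp add: matrix_matrix_mult_def transpose_def sum_3)
  then show "?A$1$3 = 0" "?A$2$3 = 0" by (simp_all add: sum_squares_eq_zero_iff)
qed

lemma diag3_tri_perm_map:
  assumes "\<sigma> permutes {1..3}"
  shows "diag3 1 1 d ** tri.perm_map \<sigma> = tri.perm_map \<sigma> ** diag3 1 1 d"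
  using tri_perm_map_entries[OF assms]
  by (simp add: vec_eq_iff forall_3 matrix_matrix_mult_def sum_3 diag3_def)

lemma det_diag3: "det (diag3 a b c) = a * b * c"
  by (simp add: det_3 diag3_def)

lemma det_tri_perm_map: "\<sigma> permutes {1..3} \<Longrightarrow> det (tri.perm_map \<sigma>) \<in> {1, - 1}"
  using det_orthogonal_matrix[OF tri.orthogonal_perm_map] by blast

lemma tri_rot_stab:
  assumes "\<sigma> permutes {1..3}"
  shows "tri_rot \<sigma> \<in> stab cubic_S3"
proof -
  have "orthogonal_matrix (diag3 1 1 (det (tri.perm_map \<sigma>)))"
    using det_tri_perm_map[OF assms]
    by (auto simp: orthogonal_matrix_def diag3_def mat3_simps)
  then have "rotation_matrix (tri_rot \<sigma>)"
    using det_tri_perm_map[OF assms] tri.orthogonal_perm_map[OF assms]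
    by (auto simp: rotation_matrix_def tri_rot_def orthogonal_matrix_mul det_mul det_diag3)
  moreover have "cubic_S3 (tri_rot \<sigma> *v v) = cubic_S3 v" for v
    using cubic_S3_perm_map[OF assms] 
    by (simp add: tri_rot_def flip: matrix_vector_mul_assoc) (simp add: cubic_S3_def)
  ultimately show ?thesis by (simp add: stab_iff)
qed

lemma tri_rot_mult:
  assumes "\<sigma> permutes {1..3}" "\<tau> permutes {1..3}"
  shows "tri_rot (\<sigma> \<circ> \<tau>) = tri_rot \<sigma> ** tri_rot \<tau>"
proof -
  let ?d = "det (tri.perm_map \<sigma>)" and ?e = "det (tri.perm_map \<tau>)"
  have "tri_rot \<sigma> ** tri_rot \<tau> = tri.perm_map \<sigma> ** (diag3 1 1 ?d ** tri.perm_map \<tau>) ** diag3 1 1 ?e"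
    by (simp add: tri_rot_def matrix_mul_assoc)
  also have "\<dots> = tri.perm_map \<sigma> ** tri.perm_map \<tau> ** (diag3 1 1 ?d ** diag3 1 1 ?e)"
    by (simp add: diag3_tri_perm_map[OF assms(2)]) (simp add: matrix_mul_assoc)
  also have "\<dots> = tri_rot (\<sigma> \<circ> \<tau>)"
    unfolding tri_rot_def tri.perm_map_mult[OF assms, symmetric] by (simp add: det_mul diag3_mult)
  finally show ?thesis by simp
qed

lemma inj_tri_rot: "inj_on tri_rot {\<sigma>. \<sigma> permutes {1..3}}"
proof (rule inj_onI)
  fix \<sigma> \<tau> assume *: "\<sigma> \<in> {\<sigma>. \<sigma> permutes {1..3}}" "\<tau> \<in> {\<sigma>. \<sigma> permutes {1..3}}" "tri_rot \<sigma> = tri_rot \<tau>"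
  \<comment> \<open>The corner entry records the determinant, so the correction by
    \<open>diag3\<close> can be undone from the matrix alone.\<close>
  have entry: "tri_rot \<rho> $3$3 = det (tri.perm_map \<rho>)" if "\<rho> permutes {1..3}" for \<rho>
    using tri_perm_map_entries[OF that] by (simp add: tri_rot_def matrix_matrix_mult_def sum_3 diag3_def)
  have undo: "tri.perm_map \<rho> = tri_rot \<rho> ** diag3 1 1 (tri_rot \<rho> $3$3)" if "\<rho> permutes {1..3}" for \<rho>
    unfolding entry[OF that] using det_tri_perm_map[OF that]
    by (auto simp: tri_rot_def diag3_mult diag3_one simp flip: matrix_mul_assoc)
  have "tri.perm_map \<sigma> = tri.perm_map \<tau>" using undo * by (metis mem_Collect_eq)
  then show "\<sigma> = \<tau>" using * inj_onD[OF tri.inj_perm_map] by blast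
qed

lemma stab_S3_eq: "s > 0 \<Longrightarrow> stab (cubic (Form_S3 s)) = stab cubic_S3"
  by (auto simp: stab_iff)

lemmas stab_cubic_S3 = stab_S3[of 1, unfolded stab_S3_eq[OF zero_less_one], OF zero_less_one]

lemma card_stab_S3: "finite (stab cubic_S3)" "card (stab cubic_S3) \<le> 6"
proof -
  have f: "finite {w::complex. w ^ 3 = 1}" and c: "card {w::complex. w ^ 3 = 1} = 3"
    by (simp_all add: finite_nth_roots card_roots_unity_eq)
  show "finite (stab cubic_S3)" unfolding stab_cubic_S3 using f by simp
  show "card (stab cubic_S3) \<le> 6" unfolding stab_cubic_S3
    using card_image_le[OF f, of rotz] card_image_le[OF f, of "\<lambda>w. rotz w ** flip"] c
    by (intro order_trans[OF card_Un_le]) linarith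
qed

lemma stab_S3_iso: "stab_group cubic_S3 \<cong> sym_group 3" "card (stab cubic_S3) = 6"
proof -
  have perm: "\<sigma> permutes {1..3}" if "\<sigma> \<in> carrier (sym_group 3)" for \<sigma>
    using that by (simp add: sym_group_carrier)
  have 1: "tri_rot \<in> hom (sym_group 3) (stab_group cubic_S3)"
    using perm by (intro homI) (simp_all add: tri_rot_stab sym_group_mult tri_rot_mult)
  have 2: "inj_on tri_rot (carrier (sym_group 3))"
    using perm by (intro inj_on_subset[OF inj_tri_rot]) blast
  have c: "card (carrier (sym_group 3)) = 6"
    using sym_group_card_carrier[of 3] by (simp add: fact_numeral)
  have 3: "tri_rot \<in> iso (sym_group 3) (stab_group cubic_S3)"
    "card (stab cubic_S3) = card (carrier (sym_group 3))"
    using iso_by_card[OF 1 2] card_stab_S3 c by simp_all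
  then show "card (stab cubic_S3) = 6" using c by simp
  have "sym_group 3 \<cong> stab_group cubic_S3" using 3(1) by (auto simp: is_iso_def)
  then show "stab_group cubic_S3 \<cong> sym_group 3" by (rule group.iso_sym[OF sym_group_is_group])
qed

lemma stab_S3_generate: "stab cubic_S3 = generate SO3 {flip, rotz (cis (2 * pi / 3))}"
proof
  let ?S = "{flip, rotz (cis (2 * pi / 3))}"
  have r: "generate SO3 {rotz (cis (2 * pi / 3))} = rotz ` {w. w ^ 3 = 1}"
    using generate_rotz_roots[of 3] by simp
  have S: "?S \<subseteq> stab cubic_S3"
    unfolding stab_cubic_S3 using cis_power_eq_1[of 3] rotz_one
    by (auto simp: image_iff intro!: exI[of _ 1] disjI2)
  then show "generate SO3 ?S \<subseteq> stab cubic_S3"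
    by (rule group.generate_subgroup_incl[OF group_SO _ subgroup_stab])
  have "?S \<subseteq> carrier SO3"
    using rotation_matrix_flip rotation_matrix_rotz by simp
  then have sub: "subgroup (generate SO3 ?S) SO3"
    by (rule group.generate_is_subgroup[OF group_SO])
  have "rotz ` {w. w ^ 3 = 1} \<subseteq> generate SO3 ?S"
    unfolding r[symmetric] by (rule group.mono_generate[OF group_SO]) simp
  moreover have "flip \<in> generate SO3 ?S" by (simp add: generate.incl)
  ultimately show "stab cubic_S3 \<subseteq> generate SO3 ?S"
    unfolding stab_cubic_S3 using subgroup_SO_mult[OF sub] by blast
qed

section \<open>Normal forms\<close>

lemma unit_power_solution:
  assumes "cmod u = cmod c" "n > 0"
  obtains w where "cmod w = 1" "c * w ^ n = u"
proof (cases "c = 0")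
  case True
  then show ?thesis using assms that[of 1] by simp
next
  case False
  then have "u / c \<noteq> 0" using assms(1) by auto
  then obtain w where w: "w \<noteq> 0" "u / c = w ^ n"
    using exists_complex_root_nonzero[of "u / c" n] assms(2) by auto
  have "cmod w ^ n = 1"
    using False assms(1) by (simp add: norm_divide flip: norm_power w(2))
  then have "cmod w = 1"
    using assms(2) by (metis norm_ge_zero power_eq_imp_eq_base power_one zero_le_one)
  then show ?thesis using w(2) False that[of w] by (simp add: field_simps)
qed

lemma pullback_rotz_wform: "cmod w = 1 \<Longrightarrow> pullback (rotz w) (wform a b c d) = wform a (b * w) (c * w^2) (d * w^3)"
  by (simp add: pullback_def wform_rotz fun_eq_iff)

lemma pullback_flip_wform: "pullback flip (wform a b c d) = wform (- a) (cnj b) (- cnj c) (cnj d)"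
  by (simp add: pullback_def wform_flip fun_eq_iff)

text \<open>Only the moduli of \<open>c\<close> and \<open>d\<close> need to be kept, because a
  rotation about the \<open>z\<close>-axis adjusts the phase afterwards.\<close>

lemma wform_abs_orbit:
  obtains c' d' where "wform \<bar>a\<bar> 0 c' d' \<in> orbit SO3 pullback (wform a 0 c d)"
    "cmod c' = cmod c" "cmod d' = cmod d"
proof (cases "a \<ge> 0")
  case True
  then show ?thesis using that[of c d] orbit_refl by simp
next
  case False
  have "wform (- a) 0 (- cnj c) (cnj d) \<in> orbit SO3 pullback (wform a 0 c d)"
    using pullback_flip_wform[of a 0 c d] rotation_matrix_flip by (auto simp: orbit_iff)
  then show ?thesis using that[of "- cnj c" "cnj d"] False by simp
qed

lemma wform_c_orbit:
  "wform \<bar>a\<bar> 0 (- 3 * \<i> * of_real (cmod c / 3)) 0 \<in> orbit SO3 pullback (wform a 0 c 0)"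
proof -
  obtain c' d' where *: "wform \<bar>a\<bar> 0 c' d' \<in> orbit SO3 pullback (wform a 0 c 0)"
    "cmod c' = cmod c" "cmod d' = cmod 0" by (rule wform_abs_orbit[of a c 0])
  \<comment> \<open>The phase is that of \<open>6 s x y z\<close> in \<open>cubic_eq_wform\<close>,
    with \<open>s = cmod c / 3\<close>.\<close>
  define u where "u = - 3 * \<i> * complex_of_real (cmod c / 3)"
  have "cmod u = cmod c'" by (simp add: u_def norm_mult norm_divide *(2))
  then obtain w where w: "cmod w = 1" "c' * w^2 = u"
    using unit_power_solution[of u c' 2] by auto
  have "wform \<bar>a\<bar> 0 u 0 = pullback (rotz w) (wform \<bar>a\<bar> 0 c' 0)"
    by (simp add: pullback_rotz_wform w)
  then have "wform \<bar>a\<bar> 0 u 0 \<in> orbit SO3 pullback (wform \<bar>a\<bar> 0 c' 0)"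
    using rotation_matrix_rotz[OF w(1)] unfolding orbit_iff by blast
  moreover have "d' = 0" using *(3) by simp
  ultimately show ?thesis using orbit_trans[OF *(1)] unfolding u_def by blast
qed

lemma wform_d_orbit: "wform \<bar>a\<bar> 0 0 (of_real (cmod d)) \<in> orbit SO3 pullback (wform a 0 0 d)"
proof -
  obtain c' d' where *: "wform \<bar>a\<bar> 0 c' d' \<in> orbit SO3 pullback (wform a 0 0 d)"
    "cmod c' = cmod 0" "cmod d' = cmod d" by (rule wform_abs_orbit[of a 0 d])
  then obtain w where w: "cmod w = 1" "d' * w^3 = of_real (cmod d)"
    using unit_power_solution[of "of_real (cmod d)" d' 3] by auto
  have "wform \<bar>a\<bar> 0 0 (of_real (cmod d)) = pullback (rotz w) (wform \<bar>a\<bar> 0 0 d')"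
    by (simp add: pullback_rotz_wform w)
  then have "wform \<bar>a\<bar> 0 0 (of_real (cmod d)) \<in> orbit SO3 pullback (wform \<bar>a\<bar> 0 0 d')"
    using rotation_matrix_rotz[OF w(1)] unfolding orbit_iff by blast
  moreover have "c' = 0" using *(2) by simp
  ultimately show ?thesis using orbit_trans[OF *(1)] by blast
qed

text \<open>For \<open>s = r\<close> the form is \<open>r z (2 z\<^sup>2 - 3 (x - y)\<^sup>2)\<close>.\<close>
lemma Z2_degenerate: "cubic (Form_Z2 r r) \<in> orbit SO3 pullback (cubic (Form_S3 (2 * r)))"
proof -
  define q where "q = 1 / sqrt 2"
  have q: "q * q = 1 / 2" "q * (q * x) = x / 2" for x
    by (simp_all add: q_def)
  \<comment> \<open>The first two rows send \<open>z\<close> and \<open>(x - y) / sqrt 2\<close> to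
    the variables of \<open>x^3 - 3 x y^2\<close>; the last completes them to a positively oriented
    orthonormal basis.\<close>
  let ?A = "vector [vector [0, 0, 1], vector [q, - q, 0], vector [q, q, 0]] :: real^3^3"
  have "rotation_matrix ?A"
    by (simp add: rotation_matrix_def orthogonal_matrix_def det_3 mat3_simps q)
  moreover have "cubic (Form_Z2 r r) = pullback ?A (cubic (Form_S3 (2 * r)))"
    by (simp add: fun_eq_iff pullback_def cubic_SO2_def cubic_A4_def cubic_S3_def Let_def
        matrix_vector_mult_def sum_3 power2_eq_square power3_eq_cube algebra_simps q)
  ultimately show ?thesis by (auto simp: orbit_iff)
qed

text \<open>For \<open>s = r \<surd>2\<close> the form is a product of three orthogonal linear forms.\<close>
lemma Z3_degenerate: "cubic (Form_Z3 r (r * sqrt 2)) \<in> orbit SO3 pullback (cubic (Form_A4 (sqrt 3 * r)))"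
proof -
  \<comment> \<open>The three linear factors are the tripod coordinates. Normalizing them costs
    \<open>(sqrt 3)^3\<close>, and \<open>6 * sqrt 3 * r / (sqrt 3)^3 = 2 * r\<close> is the
    coefficient of \<open>z^3\<close>.\<close>
  define A :: "real^3^3" where "A = (1 / sqrt 3) *\<^sub>R vector [tripod 1, tripod 2, tripod 3]"
  have "rotation_matrix A"
    by (simp add: A_def tripod_def rotation_matrix_def orthogonal_matrix_def det_3 mat3_simps field_simps sqrt_simps)
  moreover have "cubic (Form_Z3 r (r * sqrt 2)) = pullback A (cubic (Form_A4 (sqrt 3 * r)))"
    by (simp add: A_def tripod_def fun_eq_iff pullback_def cubic_SO2_def cubic_A4_def cubic_S3_def Let_def
        matrix_vector_mult_def sum_3 power2_eq_square power3_eq_cube field_simps sqrt_simps)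
  ultimately show ?thesis by (auto simp: orbit_iff)
qed

lemma wform_c_classification: "\<exists>p. admissible p \<and> wform a 0 c 0 \<in> orbit SO3 pullback (cubic p)"
proof -
  define r s where "r = \<bar>a\<bar>" and "s = cmod c / 3"
  have rs: "r \<ge> 0" "s \<ge> 0" by (simp_all add: r_def s_def)
  have orb: "wform a 0 c 0 \<in> orbit SO3 pullback (cubic (Form_Z2 r s))"
    unfolding cubic_eq_wform r_def s_def by (rule orbit_sym, rule wform_c_orbit)
  consider "r = 0" "s = 0" | "r > 0" "s = 0" | "r = 0" "s > 0" | "r = s" "s > 0"
    | "r > 0" "s > 0" "s \<noteq> r" using rs by linarith
  then show ?thesis
  proof cases
    case 1
    then show ?thesis using orb by (intro exI[of _ Form_SO3]) simp
  next
    case 2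
    then show ?thesis using orb by (intro exI[of _ "Form_SO2 r"]) simp
  next
    case 3
    then show ?thesis using orb by (intro exI[of _ "Form_A4 s"]) simp
  next
    case 4
    then show ?thesis
      using orbit_trans[OF Z2_degenerate[of s]] orb by (intro exI[of _ "Form_S3 (2 * s)"]) simp
  next
    case 5
    then show ?thesis using orb by (intro exI[of _ "Form_Z2 r s"]) simp
  qed
qed

lemma wform_d_classification: "\<exists>p. admissible p \<and> wform a 0 0 d \<in> orbit SO3 pullback (cubic p)"
proof -
  define r s where "r = \<bar>a\<bar>" and "s = cmod d"
  have rs: "r \<ge> 0" "s \<ge> 0" by (simp_all add: r_def s_def)
  have orb: "wform a 0 0 d \<in> orbit SO3 pullback (cubic (Form_Z3 r s))"
    unfolding cubic_eq_wform r_def s_def by (rule orbit_sym, rule wform_d_orbit)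
  consider "r = 0" "s = 0" | "r > 0" "s = 0" | "r = 0" "s > 0" | "s = r * sqrt 2" "r > 0"
    | "r > 0" "s > 0" "s \<noteq> r * sqrt 2" using rs by fastforce
  then show ?thesis
  proof cases
    case 1
    then show ?thesis using orb by (intro exI[of _ Form_SO3]) simp
  next
    case 2
    then show ?thesis using orb by (intro exI[of _ "Form_SO2 r"]) simp
  next
    case 3
    then show ?thesis using orb by (intro exI[of _ "Form_S3 s"]) simp
  next
    case 4
    then show ?thesis
      using orbit_trans[OF Z3_degenerate[of r]] orb by (intro exI[of _ "Form_A4 (sqrt 3 * r)"]) simp
  next
    case 5
    then show ?thesis using orb by (intro exI[of _ "Form_Z3 r s"]) simp
  qed
qed

lemma nontrivial_stab_classification:
  assumes "h \<in> harmonic_homogeneous 3" "g \<in> stab h" "g \<noteq> mat 1"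
  shows "\<exists>p. admissible p \<and> h \<in> orbit SO3 pullback (cubic p)"
proof -
  have "rotation_matrix g" using assms(2) by (simp add: stab_iff)
  then obtain u where u: "norm u = 1" "g *v u = u" by (rule rotation_matrix_axis)
  obtain R :: "real^3^3" where R: "rotation_matrix R" "R *v z_axis = u"
    by (rule rotation_matrix_exists_basis[of u 3]) (use u(1) in simp_all)
  define g' where "g' = transpose R ** g ** R"
  have g': "g' \<in> stab (pullback R h)"
    unfolding g'_def stab_pullback[OF R(1)] using assms(2) by blast
  have "g' *v z_axis = z_axis"
    using rotation_matrix_cancel(1)[OF R(1), of z_axis] R(2) u(2)
    by (simp add: g'_def flip: matrix_vector_mul_assoc)
  then have "g'$3$3 = 1" by (simp add: axis_3_fixed_iff)
  moreover have "rotation_matrix g'" using g' by (simp add: stab_iff)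
  ultimately obtain w where w: "cmod w = 1" "g' = rotz w" using rotation_fixing_z by metis
  have "w \<noteq> 1"
  proof
    assume "w = 1"
    then have "transpose R ** g ** R = transpose R ** mat 1 ** R"
      using w(2) by (simp add: g'_def rotz_one rotation_matrix_inverse[OF R(1)])
    then show False using assms(3) injD[OF inj_conjugate[OF R(1)]] by blast
  qed
  obtain a b c d where h: "pullback R h = wform a b c d"
    by (rule harmonic_homogeneous_imp_wform[OF harmonic_homogeneous_pullback[OF assms(1) R(1)]])
  have bcd: "b * w = b" "c * w^2 = c" "d * w^3 = d"
    using g' w unfolding h by (simp_all add: rotz_in_stab_wform)
  then have "b = 0" using \<open>w \<noteq> 1\<close> by simp
  moreover have "c = 0 \<or> d = 0"
  proof (rule ccontr)
    assume "\<not> ?thesis"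
    then have "w^2 = 1" "w^3 = 1" using bcd by simp_all
    then have "w = 1" by (simp add: power3_eq_cube power2_eq_square)
    then show False using \<open>w \<noteq> 1\<close> by simp
  qed
  ultimately obtain p where "admissible p" "pullback R h \<in> orbit SO3 pullback (cubic p)"
    using wform_c_classification[of a c] wform_d_classification[of a d] unfolding h by blast
  moreover have "pullback R h \<in> orbit SO3 pullback h"
    using R(1) unfolding orbit_iff by blast
  then have "h \<in> orbit SO3 pullback (pullback R h)" by (rule orbit_sym)
  ultimately show ?thesis using orbit_trans by blast
qed

section \<open>Uniqueness of the normal form\<close>

lemma card_stab_pullback:
  assumes "rotation_matrix R"
  shows "card (stab (pullback R h)) = card (stab h)"
  unfolding stab_pullback[OF assms] using inj_conjugate[OF assms]
  by (intro card_image) (rule inj_on_subset, auto)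

text \<open>The circle contains the \<open>n\<close> roots of unity of order \<open>n\<close> for
  every \<open>n\<close>, which exceeds any finite cardinality.\<close>

lemma infinite_rotz: "infinite (rotz ` {w. cmod w = 1})"
proof
  assume "finite (rotz ` {w. cmod w = 1})"
  then have fin: "finite {w. cmod w = 1}" by (rule finite_imageD) (auto simp: inj_on_def)
  have "n \<le> card {w. cmod w = 1}" if "n > 0" for n
  proof -
    have "{w. w ^ n = 1} \<subseteq> {w. cmod w = 1}" using norm_root_of_unity that by blast
    then have "card {w::complex. w ^ n = 1} \<le> card {w. cmod w = 1}" by (rule card_mono[OF fin])
    then show ?thesis using card_roots_unity_eq[OF that] by simp
  qed
  from this[of "Suc (card {w. cmod w = 1})"] show False by simp
qed

text \<open>Since \<open>card\<close> is 0 on infinite sets, the \<open>SO2\<close> type also gets a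
  value differing from those of the finite types. The zero form is separated by
  \<open>cubic_eq_0_iff\<close>.\<close>

lemma card_stab_cubic:
  "r > 0 \<Longrightarrow> card (stab (cubic (Form_SO2 r))) = 0"
  "s > 0 \<Longrightarrow> card (stab (cubic (Form_A4 s))) = 12"
  "s > 0 \<Longrightarrow> card (stab (cubic (Form_S3 s))) = 6"
  "admissible (Form_Z2 r s) \<Longrightarrow> card (stab (cubic (Form_Z2 r s))) = 2"
  "admissible (Form_Z3 r s) \<Longrightarrow> card (stab (cubic (Form_Z3 r s))) = 3"
  by (simp_all only: stab_SO2 stab_A4_eq stab_S3_eq stab_Z2 stab_Z3 card_rotz_roots
      card.infinite[OF infinite_rotz] stab_A4_iso(2) stab_S3_iso(2) zero_less_numeral)

lemma cubic_eq_0_iff: "admissible p \<Longrightarrow> cubic p = (\<lambda>v. 0) \<longleftrightarrow> p = Form_SO3"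
proof -
  assume p: "admissible p"
  have "(\<lambda>v. 0) = wform 0 0 0 0" by (simp add: fun_eq_iff wform_def)
  then show ?thesis
    using p by (cases p) (simp_all only: cubic_eq_wform wform_eq_iff, auto)
qed

text \<open>On the sphere through \<open>x\<close> the function \<open>f\<close> has a positive
  maximum, which \<open>g\<close> preserves. Comparing the maxima of the two sides of
  \<open>eq\<close> gives equal factors.\<close>

lemma scale_determined:
  fixes f :: "real^3 \<Rightarrow> real"
  assumes "continuous_on UNIV f" "f x > 0" "s > 0" "t > 0" "rotation_matrix g"
    and eq: "\<And>v. t * f v = s * f (g *v v)"
  shows "s = t"
proof -
  have "continuous_on (sphere 0 (norm x)) f" using assms(1) continuous_on_subset by blast
  then obtain v where v: "norm v = norm x" and max: "\<And>u. norm u = norm x \<Longrightarrow> f u \<le> f v"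
    using continuous_attains_sup[of "sphere 0 (norm x)" f] by auto
  have pos: "f v > 0" using max[of x] assms(2) by simp
  have "t * f v \<le> s * f v"
    using eq[of v] max[of "g *v v"] v assms(3,5) by (simp add: norm_rotation_matrix)
  moreover have "s * f v \<le> t * f v"
    using eq[of "transpose g *v v"] max[of "transpose g *v v"] v assms(4,5)
    by (simp add: norm_rotation_matrix rotation_matrix_transpose rotation_matrix_cancel) (metis less_imp_le mult_left_mono)
  ultimately show ?thesis using pos by simp
qed

lemma continuous_on_cubics:
  "continuous_on UNIV cubic_SO2" "continuous_on UNIV cubic_A4" "continuous_on UNIV cubic_S3"
  unfolding cubic_SO2_def[abs_def] cubic_A4_def[abs_def] cubic_S3_def[abs_def] Let_def
  by (intro continuous_intros)+

lemma rotz_fixed: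
  assumes "w \<noteq> 1" "rotz w *v v = v"
  shows "v$1 = 0" "v$2 = 0"
proof -
  have "w * hor v = hor (rotz w *v v)" by (simp add: complex_eq_iff)
  then have "(w - 1) * hor v = 0" using assms(2) by (simp add: algebra_simps)
  then have "hor v = 0" using assms(1) by simp
  then show "v$1 = 0" "v$2 = 0" by (simp_all add: complex_eq_iff)
qed

text \<open>Conjugated by \<open>g\<close>, the rotation \<open>rotz w\<close> lies in the second
  stabilizer and so fixes the \<open>z\<close>-axis. Hence \<open>rotz w\<close> fixes the image of
  \<open>z_axis\<close> under \<open>g\<close>, and its fixed line is the \<open>z\<close>-axis
  because \<open>w \<noteq> 1\<close>.\<close>

lemma orbit_z_line:
  assumes "rotation_matrix g" "rotz w \<in> stab h" "w \<noteq> 1" "stab (pullback g h) \<subseteq> range rotz"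
  shows "g$1$3 = 0" "g$2$3 = 0"
proof -
  obtain u where u: "transpose g ** rotz w ** g = rotz u"
    using assms(2,4) stab_pullback[OF assms(1)] by blast
  have "(transpose g ** rotz w ** g) *v z_axis = z_axis"
    unfolding u by (simp add: vec_eq_iff forall_3 axis_def)
  then have "g *v (transpose g *v (rotz w *v (g *v z_axis))) = g *v z_axis"
    by (simp flip: matrix_vector_mul_assoc)
  then have "rotz w *v (g *v z_axis) = g *v z_axis"
    by (simp add: rotation_matrix_cancel assms(1))
  from rotz_fixed[OF assms(3) this] show "g$1$3 = 0" "g$2$3 = 0"
    by (simp_all add: matrix_vector_mult_def sum_3 axis_def)
qed

text \<open>Reversing the axis would negate \<open>a\<close>, against the positivity of both leading
  coefficients; a rotation about the axis changes only phases.\<close>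

lemma wform_orbit_parameters:
  assumes "wform a' 0 c' d' = pullback g (wform a 0 c d)" "a > 0" "a' > 0"
    and "rotation_matrix g" "g$1$3 = 0" "g$2$3 = 0"
  shows "a' = a" "cmod c' = cmod c" "cmod d' = cmod d"
proof -
  have "a' = a \<and> cmod c' = cmod c \<and> cmod d' = cmod d"
    using assms(4-6)
  proof (rule rotation_z_line)
    fix w assume "cmod w = 1" "g = rotz w"
    then show ?thesis
      using assms(1) by (simp add: pullback_rotz_wform wform_eq_iff norm_mult norm_power)
  next
    fix w assume "cmod w = 1" "g = rotz w ** flip"
    then show ?thesis
      using assms(1-3) by (simp add: pullback_mult pullback_rotz_wform pullback_flip_wform wform_eq_iff)
  qed
  then show "a' = a" "cmod c' = cmod c" "cmod d' = cmod d" by blast+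
qed

lemma orbit_Z2:
  assumes "cubic (Form_Z2 r' s') = pullback g (cubic (Form_Z2 r s))" "rotation_matrix g"
    "admissible (Form_Z2 r s)" "admissible (Form_Z2 r' s')"
  shows "r' = r" "s' = s"
proof -
  have "rotz (- 1) \<in> stab (cubic (Form_Z2 r s))" unfolding stab_Z2[OF assms(3)] by simp
  moreover have "stab (pullback g (cubic (Form_Z2 r s))) \<subseteq> range rotz"
    unfolding assms(1)[symmetric] stab_Z2[OF assms(4)] by blast
  ultimately have "g$1$3 = 0" "g$2$3 = 0"
    using orbit_z_line[OF assms(2)] by force+
  then have "r' = r \<and> cmod (- 3 * \<i> * of_real s') = cmod (- 3 * \<i> * of_real s)"
    using wform_orbit_parameters[OF assms(1)[unfolded cubic_eq_wform]] assms(2-4) by auto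
  then show "r' = r" "s' = s" using assms(3,4) by (auto simp: norm_mult)
qed

lemma orbit_Z3:
  assumes "cubic (Form_Z3 r' s') = pullback g (cubic (Form_Z3 r s))" "rotation_matrix g"
    "admissible (Form_Z3 r s)" "admissible (Form_Z3 r' s')"
  shows "r' = r" "s' = s"
proof -
  have "cis (2 * pi / 3) \<noteq> 1"
    by (simp add: complex_eq_iff cos_120)
  moreover have "rotz (cis (2 * pi / 3)) \<in> stab (cubic (Form_Z3 r s))"
    unfolding stab_Z3[OF assms(3)] using cis_power_eq_1[of 3] by simp
  moreover have "stab (pullback g (cubic (Form_Z3 r s))) \<subseteq> range rotz"
    unfolding assms(1)[symmetric] stab_Z3[OF assms(4)] by blast
  ultimately have "g$1$3 = 0" "g$2$3 = 0"
    using orbit_z_line[OF assms(2)] by blast+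
  then have "r' = r \<and> cmod (of_real s') = cmod (of_real s)"
    using wform_orbit_parameters[OF assms(1)[unfolded cubic_eq_wform]] assms(2-4) by auto
  then show "r' = r" "s' = s" using assms(3,4) by auto
qed

lemma cubic_orbit_unique:
  assumes "admissible p" "admissible q" "cubic q \<in> orbit SO3 pullback (cubic p)"
  shows "q = p"
proof -
  obtain g where g: "rotation_matrix g" "cubic q = pullback g (cubic p)"
    using assms(3) by (auto simp: orbit_iff)
  have card: "card (stab (cubic q)) = card (stab (cubic p))"
    using card_stab_pullback[OF g(1)] g(2) by simp
  have scale: "s = t" if "continuous_on UNIV f" "f x > 0" "s > 0" "t > 0" "\<And>v. t * f v = s * f (g *v v)"
    for f :: "real^3 \<Rightarrow> real" and x s t by (rule scale_determined[of f x s t g]) (use that g in auto)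
  have zero: "q = Form_SO3 \<longleftrightarrow> p = Form_SO3"
  proof -
    have "pullback A (\<lambda>v. 0) = (\<lambda>v. 0)" for A :: "real^3^3" by (simp add: pullback_def)
    then have "cubic p = (\<lambda>v. 0) \<longleftrightarrow> cubic q = (\<lambda>v. 0)"
      using pullback_inverse(1)[OF g(1), of "cubic p"] g(2) by metis
    then show ?thesis using cubic_eq_0_iff assms(1,2) by blast
  qed
  have eq: "cubic q v = cubic p (g *v v)" for v using g(2) by (simp add: pullback_def)
  show ?thesis
  proof (cases p)
    case Form_SO3
    then show ?thesis using zero by simp
  next
    case p: (Form_SO2 r)
    then obtain r' where q: "q = Form_SO2 r'"
      using card assms zero by (cases q) (simp_all only: card_stab_cubic admissible.simps simp_thms, simp_all)
    have "r' = r"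
      using scale[OF continuous_on_cubics(1), of z_axis r r'] eq assms p q
      by (simp add: cubic_SO2_def axis_def)
    then show ?thesis using p q by simp
  next
    case p: (Form_A4 s)
    then obtain s' where q: "q = Form_A4 s'"
      using card assms zero by (cases q) (simp_all only: card_stab_cubic admissible.simps simp_thms, simp_all)
    have "s' = s"
    proof (rule scale[OF continuous_on_cubics(2), of "vector [1, 1, 1]" s s', symmetric])
      show "s' * cubic_A4 v = s * cubic_A4 (g *v v)" for v using eq[of v] p q by simp
    qed (use assms p q in \<open>simp_all add: cubic_A4_def\<close>)
    then show ?thesis using p q by simp
  next
    case p: (Form_S3 s)
    then obtain s' where q: "q = Form_S3 s'"
      using card assms zero by (cases q) (simp_all only: card_stab_cubic admissible.simps simp_thms, simp_all)
    have "s' = s"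
      using scale[OF continuous_on_cubics(3), of x_axis s s'] eq assms p q
      by (simp add: cubic_S3_def axis_def)
    then show ?thesis using p q by simp
  next
    case p: (Form_Z2 r s)
    then obtain r' s' where q: "q = Form_Z2 r' s'"
      using card assms zero by (cases q) (simp_all only: card_stab_cubic admissible.simps simp_thms, simp_all)
    then show ?thesis using orbit_Z2[of r' s' g r s] g assms p by simp
  next
    case p: (Form_Z3 r s)
    then obtain r' s' where q: "q = Form_Z3 r' s'"
      using card assms zero by (cases q) (simp_all only: card_stab_cubic admissible.simps simp_thms, simp_all)
    then show ?thesis using orbit_Z3[of r' s' g r s] g assms p by simp
  qed
qed

lemma stab_SO3: "stab (cubic Form_SO3) = carrier SO3"
  by (auto simp: stab_iff)

lemma stab_cubic_neq_singleton:
  assumes "admissible p"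
  shows "stab (cubic p) \<noteq> {A}"
proof
  assume *: "stab (cubic p) = {A}"
  then have "card (stab (cubic p)) = 1" by simp
  \<comment> \<open>None of the orders in \<open>card_stab_cubic\<close> is 1, so only the zero form
    remains, and its stabilizer has at least two elements.\<close>
  then have "p = Form_SO3"
    using assms by (cases p) (simp_all only: card_stab_cubic admissible.simps simp_thms, (simp_all)?)
  then have "mat 1 = A" "flip = A"
    using * rotation_matrix_flip rotation_matrix_one by (auto simp only: stab_SO3 SO_simps set_eq_iff singleton_iff)
  then show False by (auto simp: mat3_simps diag3_def)
qed

lemma stab_nontrivial_iff:
  assumes "h \<in> harmonic_homogeneous 3"
  shows "stab h \<noteq> {\<one>\<^bsub>SO3\<^esub>} \<longleftrightarrow> (\<exists>!p. admissible p \<and> h \<in> orbit SO3 pullback (cubic p))"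
proof
  assume "stab h \<noteq> {\<one>\<^bsub>SO3\<^esub>}"
  moreover have "mat 1 \<in> stab h" by (simp add: stab_iff rotation_matrix_one)
  ultimately obtain g where "g \<in> stab h" "g \<noteq> mat 1" by auto
  then obtain p where p: "admissible p" "h \<in> orbit SO3 pullback (cubic p)"
    using nontrivial_stab_classification[OF assms] by blast
  show "\<exists>!p. admissible p \<and> h \<in> orbit SO3 pullback (cubic p)"
  proof (rule ex1I[of _ p])
    fix q assume "admissible q \<and> h \<in> orbit SO3 pullback (cubic q)"
    then show "q = p"
      using cubic_orbit_unique[OF p(1), of q] orbit_trans[OF p(2) orbit_sym] by blast
  qed (use p in blast)
next
  assume "\<exists>!p. admissible p \<and> h \<in> orbit SO3 pullback (cubic p)"
  then obtain p g where p: "admissible p" "rotation_matrix g" "h = pullback g (cubic p)"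
    by (auto simp: orbit_iff)
  show "stab h \<noteq> {\<one>\<^bsub>SO3\<^esub>}"
  proof
    assume "stab h = {\<one>\<^bsub>SO3\<^esub>}"
    then have "card (stab h) = 1" by simp
    then have "card (stab (cubic p)) = 1"
      using card_stab_pullback[OF p(2), of "cubic p"] p(3) by simp
    then show False using stab_cubic_neq_singleton[OF p(1)] by (metis card_1_singletonE)
  qed
qed

theorem proposition1:
  shows "(\<forall>h \<in> harmonic_homogeneous 3.
            stab h \<noteq> {\<one>\<^bsub>SO3\<^esub>} \<longleftrightarrow> (\<exists>!p. admissible p \<and> h \<in> orbit SO3 pullback (cubic p)))
    \<and> stab (cubic Form_SO3) = carrier SO3
    \<and> (\<forall>r. admissible (Form_SO2 r) \<longrightarrow>
          stab (cubic (Form_SO2 r)) = range (rotation_about z_axis)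
        \<and> stab_group (cubic (Form_SO2 r)) \<cong> SO2)
    \<and> (\<forall>s. admissible (Form_A4 s) \<longrightarrow>
          stab (cubic (Form_A4 s)) =
            generate SO3 {rotation_about x_axis pi, rotation_about y_axis pi, rotation_about z_axis pi,
                          rotation_about (vector [1, 1, 1]) (2/3 * pi)}
        \<and> stab_group (cubic (Form_A4 s)) \<cong> alt_group 4
        \<and> card (stab (cubic (Form_A4 s))) = 12)
    \<and> (\<forall>s. admissible (Form_S3 s) \<longrightarrow>
          stab (cubic (Form_S3 s)) =
            generate SO3 {rotation_about x_axis pi, rotation_about z_axis (2/3 * pi)}
        \<and> stab_group (cubic (Form_S3 s)) \<cong> sym_group 3
        \<and> card (stab (cubic (Form_S3 s))) = 6)
    \<and> (\<forall>r s. admissible (Form_Z2 r s) \<longrightarrow>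
          stab (cubic (Form_Z2 r s)) = generate SO3 {rotation_about z_axis pi}
        \<and> stab_group (cubic (Form_Z2 r s)) \<cong> integer_mod_group 2)
    \<and> (\<forall>r s. admissible (Form_Z3 r s) \<longrightarrow>
          stab (cubic (Form_Z3 r s)) = generate SO3 {rotation_about z_axis (2/3 * pi)}
        \<and> stab_group (cubic (Form_Z3 r s)) \<cong> integer_mod_group 3)"
proof (intro conjI ballI allI impI)
  \<comment> \<open>Puts the angles in the form \<open>2 * pi / n\<close> expected by
    \<open>generate_rotz_roots\<close>.\<close>
  have z3: "rotation_about z_axis (2/3 * pi) = rotz (cis (2 * pi / real 3))"
    unfolding rotation_about_z by simp
  have z2: "rotation_about z_axis pi = rotz (cis (2 * pi / real 2))"
    unfolding rotation_about_z by simp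
  {
    fix h :: "real^3 \<Rightarrow> real" assume "h \<in> harmonic_homogeneous 3"
    then show "stab h \<noteq> {\<one>\<^bsub>SO3\<^esub>} \<longleftrightarrow> (\<exists>!p. admissible p \<and> h \<in> orbit SO3 pullback (cubic p))"
      by (rule stab_nontrivial_iff)
  next
    show "stab (cubic Form_SO3) = carrier SO3" by (rule stab_SO3)
  next
    fix r assume "admissible (Form_SO2 r)"
    then have *: "stab (cubic (Form_SO2 r)) = rotz ` {w. cmod w = 1}" by (simp only: admissible.simps stab_SO2)
    show "stab (cubic (Form_SO2 r)) = range (rotation_about z_axis)"
      unfolding * range_rotation_about_z ..
    show "stab_group (cubic (Form_SO2 r)) \<cong> SO2"
      unfolding * by (rule iso_SO2)
  next
    fix s assume "admissible (Form_A4 s)"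
    then have *: "stab (cubic (Form_A4 s)) = stab cubic_A4" by (simp only: admissible.simps stab_A4_eq)
    show "stab (cubic (Form_A4 s)) =
        generate SO3 {rotation_about x_axis pi, rotation_about y_axis pi, rotation_about z_axis pi,
                      rotation_about (vector [1, 1, 1]) (2/3 * pi)}"
      unfolding * rotation_about_pi rotation_about_111 by (rule stab_A4_generate)
    show "stab_group (cubic (Form_A4 s)) \<cong> alt_group 4" "card (stab (cubic (Form_A4 s))) = 12"
      unfolding * by (rule stab_A4_iso)+
  next
    fix s assume "admissible (Form_S3 s)"
    then have *: "stab (cubic (Form_S3 s)) = stab cubic_S3" by (simp only: admissible.simps stab_S3_eq)
    show "stab (cubic (Form_S3 s)) =
        generate SO3 {rotation_about x_axis pi, rotation_about z_axis (2/3 * pi)}"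
      unfolding * rotation_about_pi z3 using stab_S3_generate by simp
    show "stab_group (cubic (Form_S3 s)) \<cong> sym_group 3" "card (stab (cubic (Form_S3 s))) = 6"
      unfolding * by (rule stab_S3_iso)+
  next
    fix r s assume "admissible (Form_Z2 r s)"
    note * = stab_Z2[OF this]
    show "stab (cubic (Form_Z2 r s)) = generate SO3 {rotation_about z_axis pi}"
      unfolding * z2 by (rule generate_rotz_roots[symmetric]) simp
    show "stab_group (cubic (Form_Z2 r s)) \<cong> integer_mod_group 2"
      unfolding * by (rule iso_integer_mod_group) simp
  next
    fix r s assume "admissible (Form_Z3 r s)"
    note * = stab_Z3[OF this]
    show "stab (cubic (Form_Z3 r s)) = generate SO3 {rotation_about z_axis (2/3 * pi)}"
      unfolding * z3 by (rule generate_rotz_roots[symmetric]) simp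
    show "stab_group (cubic (Form_Z3 r s)) \<cong> integer_mod_group 3"
      unfolding * by (rule iso_integer_mod_group) simp
  }
qed

end
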